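(* Let $\mu\in\mathbb{R}$, $\sigma_X,\sigma_Y>0$, $P_X=N(\mu,\sigma_X^2)$ and $P_Y=N(\mu,\sigma_Y^2)$. Then for every $D\ge 0$, $$R_{\mathrm{ID}}(D,P_X,P_Y)=\begin{cases}0 & \text{for } 0\le D<(\sigma_X-\sigma_Y)^2,\\[2pt] \log\dfrac{2\sigma_X\sigma_Y}{\sigma_X^2+\sigma_Y^2-D} & \text{for } (\sigma_X-\sigma_Y)^2\le D<\sigma_X^2+\sigma_Y^2,\\[2pt] \infty & \text{for } D\ge\sigma_X^2+\sigma_Y^2,\end{cases}$$ where $\log$ is the base-2 logarithm.
   Context: $\log$ denotes the base-2 logarithm; $N(\mu,\sigma^2)$ is the Gaussian distribution on $\mathbb{R}$ with mean $\mu$ and variance $\sigma^2$. For $\mathbf{x},\mathbf{y}\in\mathbb{R}^n$ put $d(\mathbf{x},\mathbf{y})=\frac1n\sum_{i=1}^n(x_i-y_i)^2=\frac1n\|\mathbf{x}-\mathbf{y}\|^2$ (Euclidean norm). A rate-$R$ identification system of blocklength $n$ is a pair $(T,g)$ of (measurable) maps $T:\mathbb{R}^n\to\{1,2,\dots,2^{nR}\}$ (signature assignment) and $g:\{1,2,\dots,2^{nR}\}\times\mathbb{R}^n\to\{\mathtt{no},\mathtt{maybe}\}$ (query function); here $\{1,\dots,2^{nR}\}$ means the integers $i$ with $1\le i\le 2^{nR}$. It is $D$-admissible if $g(T(\mathbf{x}),\mathbf{y})=\mathtt{maybe}$ for all $\mathbf{x},\mathbf{y}\in\mathbb{R}^n$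 with $d(\mathbf{x},\mathbf{y})\le D$. Given probability distributions $P_X,P_Y$ on $\mathbb{R}$, let $(\mathbf{X},\mathbf{Y})\sim\prod_{i=1}^nP_X(x_i)P_Y(y_i)$, i.e. $\mathbf{X}$ and $\mathbf{Y}$ are independent random vectors in $\mathbb{R}^n$ with i.i.d. entries of law $P_X$ and $P_Y$ respectively. A rate $R$ is $D$-achievable if there is a sequence of rate-$R$ $D$-admissible systems $(T^{(n)},g^{(n)})$, with $(T^{(n)},g^{(n)})$ of blocklength $n$, such that $\lim_{n\to\infty}\Pr\{g^{(n)}(T^{(n)}(\mathbf{X}),\mathbf{Y})=\mathtt{maybe}\}=0$. The identification rate is $R_{\mathrm{ID}}(D,P_X,P_Y)=\inf\{R: R \text{ is } D\text{-achievable}\}$, with the infimum of the empty set equal to $\infty$. *)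

theory Defs
  imports "HOL-Probability.Probability"
begin

(* A vector in R^n is a function on the index set {..<n}, extended by undefined. *)
definition Rn :: "nat \<Rightarrow> (nat \<Rightarrow> real) measure" where
  "Rn n = (\<Pi>\<^sub>M i\<in>{..<n}. borel)"

definition dist_avg :: "nat \<Rightarrow> (nat \<Rightarrow> real) \<Rightarrow> (nat \<Rightarrow> real) \<Rightarrow> real" where
  "dist_avg n x y = (1 / real n) * (\<Sum>i<n. (x i - y i)\<^sup>2)"

definition signatures :: "real \<Rightarrow> nat \<Rightarrow> nat set" where
  "signatures R n = {i. 1 \<le> i \<and> real i \<le> 2 powr (real n * R)}"

datatype answer = No | Maybe

definition id_system ::
  "real \<Rightarrow> nat \<Rightarrow> ((nat \<Rightarrow> real) \<Rightarrow> nat) \<Rightarrow> (nat \<times> (nat \<Rightarrow> real) \<Rightarrow> answer) \<Rightarrow> bool" where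
  "id_system R n T g \<longleftrightarrow>
     T \<in> Rn n \<rightarrow>\<^sub>M count_space (signatures R n) \<and>
     g \<in> count_space (signatures R n) \<Otimes>\<^sub>M Rn n \<rightarrow>\<^sub>M count_space UNIV"

definition admissible ::
  "real \<Rightarrow> nat \<Rightarrow> ((nat \<Rightarrow> real) \<Rightarrow> nat) \<Rightarrow> (nat \<times> (nat \<Rightarrow> real) \<Rightarrow> answer) \<Rightarrow> bool" where
  "admissible D n T g \<longleftrightarrow>
     (\<forall>x\<in>space (Rn n). \<forall>y\<in>space (Rn n). dist_avg n x y \<le> D \<longrightarrow> g (T x, y) = Maybe)"

(* The joint law of (X, Y): independent, each with i.i.d. entries. *)
definition source_law :: "real measure \<Rightarrow> real measure \<Rightarrow> nat \<Rightarrow>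
    ((nat \<Rightarrow> real) \<times> (nat \<Rightarrow> real)) measure" where
  "source_law PX PY n = (\<Pi>\<^sub>M i\<in>{..<n}. PX) \<Otimes>\<^sub>M (\<Pi>\<^sub>M i\<in>{..<n}. PY)"

definition prob_maybe :: "real measure \<Rightarrow> real measure \<Rightarrow> nat \<Rightarrow>
    ((nat \<Rightarrow> real) \<Rightarrow> nat) \<Rightarrow> (nat \<times> (nat \<Rightarrow> real) \<Rightarrow> answer) \<Rightarrow> real" where
  "prob_maybe PX PY n T g =
     measure (source_law PX PY n)
       {(x, y) \<in> space (source_law PX PY n). g (T x, y) = Maybe}"

(* Blocklengths start at 1, so no negative rate is achievable: it would leave T without values. *)
definition achievable :: "real \<Rightarrow> real measure \<Rightarrow> real measure \<Rightarrow> real \<Rightarrow> bool" where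
  "achievable D PX PY R \<longleftrightarrow>
     (\<exists>T g. (\<forall>n\<ge>1. id_system R n (T n) (g n) \<and> admissible D n (T n) (g n)) \<and>
            (\<lambda>n. prob_maybe PX PY n (T n) (g n)) \<longlonglongrightarrow> 0)"

(* The infimum is taken in ereal, where Inf {} is infinity. *)
definition R_ID :: "real \<Rightarrow> real measure \<Rightarrow> real measure \<Rightarrow> ereal" where
  "R_ID D PX PY = Inf (ereal ` {R. achievable D PX PY R})"

(* The Gaussian law with mean mu and standard deviation sigma, i.e. variance sigma^2. *)
definition gaussian :: "real \<Rightarrow> real \<Rightarrow> real measure" where
  "gaussian \<mu> \<sigma> = density lborel (\<lambda>x. ennreal (normal_density \<mu> \<sigma> x))"

end

theory Submission
  imports Defs
begin

text \<open>
  Write \<open>\<rho> = (\<sigma>X\<^sup>2 + \<sigma>Y\<^sup>2 - D) / (2 \<sigma>X \<sigma>Y)\<close>. Vectors \<open>x\<close>, \<open>y\<close> of typical norm are at normalised distance at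
  most \<open>D\<close> iff the cosine of their angle is at least \<open>\<rho>\<close>, and the critical rate is \<open>log (1 / \<rho>)\<close>.

  Converse: some signature has a cell \<open>A\<close> of \<open>X\<close>-probability about \<open>a ^ n\<close>, \<open>a = 2 powr - R\<close>, whose query answers
  \<open>No\<close> on a set \<open>B\<close> of constant \<open>Y\<close>-probability. Points of \<open>A\<close> and \<open>B\<close> have cosine below \<open>\<rho>\<close>, so \<open>s A + t B\<close> lies in
  a ball that is too small for the Prekopa-Leindler inequality as soon as \<open>a > \<rho>\<close>: with volumes normalised,
  \<open>s a + t \<le> sqrt (s\<^sup>2 + t\<^sup>2 + 2 s t \<rho>)\<close> forces \<open>a \<le> \<rho>\<close> when \<open>s / t\<close> is small.

  Achievability: cover the typical \<open>x\<close> greedily by about \<open>b ^ (- n)\<close> balls of radius \<open>b \<sigma>X sqrt n\<close>, \<open>a < b < \<rho>\<close>, with centres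
  \<open>w\<close> of norm about \<open>sqrt (1 - b\<^sup>2) \<sigma>X sqrt n\<close>. If \<open>y\<close> is close to some point of the cell of \<open>w\<close>, then the inner product of
  \<open>w\<close> and \<open>y\<close> is at least of order \<open>n (\<rho> - b)\<close>, which is atypical for a \<open>y\<close> independent of \<open>w\<close>.
\<close>

section \<open>The Prekopa-Leindler inequality\<close>

lemma emeasure_lborel_affine_vimage:
  fixes s d :: real
  assumes "s > 0" and A: "A \<in> sets borel"
  shows "emeasure lborel {z. (z - d) / s \<in> A} = ennreal s * emeasure lborel A"
proof -
  have m: "{z. (z - d) / s \<in> A} \<in> sets borel"
    using measurable_sets[of "\<lambda>z. (z - d) / s" borel borel A] A by (simp add: vimage_def)
  have "emeasure lborel {z. (z - d) / s \<in> A}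
      = (\<integral>\<^sup>+z. indicator {z. (z - d) / s \<in> A} z \<partial>lborel)"
    using m by simp
  also have "\<dots> = \<bar>s\<bar> * (\<integral>\<^sup>+x. indicator {z. (z - d) / s \<in> A} (d + s * x) \<partial>lborel)"
    using m assms by (intro nn_integral_real_affine) auto
  also have "(\<integral>\<^sup>+x. indicator {z. (z - d) / s \<in> A} (d + s * x) \<partial>lborel) = (\<integral>\<^sup>+x. indicator A x \<partial>lborel)"
    using assms by (intro nn_integral_cong) (simp add: indicator_def)
  finally show ?thesis using assms by simp
qed

text \<open>Split \<open>A\<close> and \<open>B\<close> at points close to \<open>Sup A\<close> and \<open>Inf B\<close>: the two resulting translates
  inside \<open>C\<close> lie on opposite sides of one point.\<close>

lemma brunn_minkowski_real:
  fixes A B C :: "real set" and s t L :: real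
  assumes st: "s > 0" "t > 0"
    and meas [measurable]: "A \<in> sets borel" "B \<in> sets borel" "C \<in> sets borel"
    and ne: "A \<noteq> {}" "B \<noteq> {}"
    and bd: "A \<subseteq> {-L..L}" "B \<subseteq> {-L..L}"
    and sub: "\<And>a b. a \<in> A \<Longrightarrow> b \<in> B \<Longrightarrow> s * a + t * b \<in> C"
  shows "ennreal s * emeasure lborel A + ennreal t * emeasure lborel B \<le> emeasure lborel C"
proof (rule ennreal_le_epsilon)
  fix e :: real assume e: "0 < e"
  have bA: "bdd_above A" and bB: "bdd_below B"
    using bd by (meson bdd_above_Icc bdd_above_mono, meson bdd_below_Icc bdd_below_mono)
  \<comment> \<open>The tolerances are divided by \<open>s\<close> and \<open>t\<close>, so that
    each of the two cuts costs \<open>e / 2\<close> after scaling.\<close>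
  have "Sup A - e / (2 * s) < Sup A" "Inf B < Inf B + e / (2 * t)" using e st by auto
  then obtain a b where a: "a \<in> A" "Sup A - e / (2 * s) < a" and b: "b \<in> B" "b < Inf B + e / (2 * t)"
    using less_cSup_iff[OF ne(1) bA] cInf_less_iff[OF ne(2) bB] by blast
  define A' where "A' = A \<inter> {..<a}"
  define B' where "B' = B \<inter> {b..}"
  have [measurable]: "A' \<in> sets borel" "B' \<in> sets borel" by (auto simp: A'_def B'_def)
  have "emeasure lborel A \<le> emeasure lborel (A' \<union> {a..Sup A})"
    by (intro emeasure_mono) (auto simp: A'_def intro: cSup_upper[OF _ bA])
  also have "\<dots> \<le> emeasure lborel A' + emeasure lborel {a..Sup A}"
    by (intro emeasure_subadditive) auto
  also have "emeasure lborel {a..Sup A} \<le> ennreal (e / (2 * s))"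
    using a st e by (auto simp: emeasure_lborel_Icc_eq intro!: ennreal_leI)
  finally have 1: "emeasure lborel A \<le> emeasure lborel A' + ennreal (e / (2 * s))"
    by (simp add: add_left_mono)
  have "emeasure lborel B \<le> emeasure lborel (B' \<union> {Inf B..b})"
    by (intro emeasure_mono) (auto simp: B'_def intro: cInf_lower[OF _ bB])
  also have "\<dots> \<le> emeasure lborel B' + emeasure lborel {Inf B..b}"
    by (intro emeasure_subadditive) auto
  also have "emeasure lborel {Inf B..b} \<le> ennreal (e / (2 * t))"
    using b st e by (auto simp: emeasure_lborel_Icc_eq intro!: ennreal_leI)
  finally have 2: "emeasure lborel B \<le> emeasure lborel B' + ennreal (e / (2 * t))"
    by (simp add: add_left_mono)
  \<comment> \<open>\<open>?C1\<close> is \<open>s A' + t b\<close> and \<open>?C2\<close> is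
    \<open>s a + t B'\<close>. Since \<open>A'\<close> stops short of \<open>a\<close> and
    \<open>B'\<close> starts at \<open>b\<close>, the point \<open>s * a + t * b\<close> separates
    them.\<close>
  let ?C1 = "{z. (z - t * b) / s \<in> A'}" and ?C2 = "{z. (z - s * a) / t \<in> B'}"
  have m: "?C1 \<in> sets borel" "?C2 \<in> sets borel" by measurable
  have "ennreal s * emeasure lborel A + ennreal t * emeasure lborel B
      \<le> ennreal s * (emeasure lborel A' + ennreal (e / (2 * s)))
        + ennreal t * (emeasure lborel B' + ennreal (e / (2 * t)))"
    by (intro add_mono mult_left_mono 1 2) auto
  also have "\<dots> = (ennreal s * emeasure lborel A' + ennreal t * emeasure lborel B')
      + (ennreal (e / 2) + ennreal (e / 2))"
    using st e by (simp add: distrib_left ennreal_mult'[symmetric] ac_simps)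
  also have "ennreal (e / 2) + ennreal (e / 2) = ennreal e"
    using e by (simp add: ennreal_plus[symmetric] del: ennreal_plus)
  also have "ennreal s * emeasure lborel A' + ennreal t * emeasure lborel B'
      = emeasure lborel ?C1 + emeasure lborel ?C2"
    using st by (simp add: emeasure_lborel_affine_vimage)
  also have "\<dots> = emeasure lborel (?C1 \<union> ?C2)"
  proof (intro plus_emeasure)
    have False if "(z - t * b) / s < a" "b \<le> (z - s * a) / t" for z
      using that st by (simp add: field_simps)
    then show "?C1 \<inter> ?C2 = {}" unfolding A'_def B'_def by auto
  qed (use m in auto)
  also have "\<dots> \<le> emeasure lborel C"
  proof (intro emeasure_mono subsetI)
    fix z assume "z \<in> ?C1 \<union> ?C2"
    then have "s * ((z - t * b) / s) + t * b \<in> C \<or> s * a + t * ((z - s * a) / t) \<in> C"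
      using sub a b unfolding A'_def B'_def by blast
    then show "z \<in> C" using st by simp
  qed simp
  finally show "ennreal s * emeasure lborel A + ennreal t * emeasure lborel B \<le> emeasure lborel C + ennreal e"
    by (simp add: add_right_mono)
qed

text \<open>Fubini on the region under the graph. The factor \<open>indicator {0<..} u\<close> cuts
  off the negative levels, where the superlevel set is the whole line.\<close>

lemma layer_cake:
  fixes f :: "real \<Rightarrow> real"
  assumes [measurable]: "f \<in> borel_measurable borel" and "\<And>x. 0 \<le> f x"
  shows "(\<integral>\<^sup>+x. ennreal (f x) \<partial>lborel)
    = (\<integral>\<^sup>+u. indicator {0<..} u * emeasure lborel {x. u < f x} \<partial>lborel)"
proof -
  have "(\<integral>\<^sup>+x. ennreal (f x) \<partial>lborel) = (\<integral>\<^sup>+x. (\<integral>\<^sup>+u. indicator {0<..<f x} u \<partial>lborel) \<partial>lborel)"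
    using assms by simp
  also have "\<dots> = (\<integral>\<^sup>+x. (\<integral>\<^sup>+u. indicator {(x, u). 0 < u \<and> u < f x} (x, u) \<partial>lborel) \<partial>lborel)"
    by (intro nn_integral_cong) (auto simp: indicator_def)
  also have "\<dots> = (\<integral>\<^sup>+u. (\<integral>\<^sup>+x. indicator {(x, u). 0 < u \<and> u < f x} (x, u) \<partial>lborel) \<partial>lborel)"
    by (rule lborel_pair.Fubini'[symmetric]) measurable
  also have "\<dots> = (\<integral>\<^sup>+u. (\<integral>\<^sup>+x. indicator {0<..} u * indicator {x. u < f x} x \<partial>lborel) \<partial>lborel)"
    by (intro nn_integral_cong) (auto simp: indicator_def)
  also have "\<dots> = (\<integral>\<^sup>+u. indicator {0<..} u * emeasure lborel {x. u < f x} \<partial>lborel)"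
    by (simp add: nn_integral_cmult)
  finally show ?thesis .
qed

text \<open>A single \<open>L\<close> bounds both values and support. This makes the function
  integrable and keeps its positive superlevel sets inside the interval that
  \<open>brunn_minkowski_real\<close> asks for.\<close>

definition bounded_compact :: "(real \<Rightarrow> real) \<Rightarrow> bool" where
  "bounded_compact f \<longleftrightarrow> f \<in> borel_measurable borel \<and>
     (\<exists>L. \<forall>x. 0 \<le> f x \<and> f x \<le> L \<and> (f x \<noteq> 0 \<longrightarrow> \<bar>x\<bar> \<le> L))"

lemma bounded_compact_integrable:
  assumes "bounded_compact f"
  shows "integrable lborel f"
proof -
  from assms obtain L where [measurable]: "f \<in> borel_measurable borel"
    and L: "\<And>x. 0 \<le> f x \<and> f x \<le> L \<and> (f x \<noteq> 0 \<longrightarrow> \<bar>x\<bar> \<le> L)"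
    unfolding bounded_compact_def by auto
  show ?thesis
  proof (rule Bochner_Integration.integrable_bound)
    show "integrable lborel (\<lambda>x. L * indicator {-L..L} x)"
      by (intro integrable_mult_right integrable_real_indicator) (auto simp: emeasure_lborel_Icc_eq)
    show "AE x in lborel. norm (f x) \<le> norm (L * indicator {-L..L} x)"
    proof (rule AE_I2)
      fix x show "norm (f x) \<le> norm (L * indicator {-L..L} x)"
        using L[of x] by (cases "f x = 0") (auto simp: indicator_def abs_le_iff minus_le_iff)
    qed
  qed simp
qed

text \<open>The best constant in Young's inequality for \<open>s * X + t * Y\<close>; it equals 1 in
  the classical case \<open>s = l\<close>, \<open>t = 1 - l\<close>. Free \<open>s\<close> and
  \<open>t\<close> allow two sets to be rescaled separately later on.\<close>

definition pl_const :: "real \<Rightarrow> real \<Rightarrow> real \<Rightarrow> real" where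
  "pl_const l s t = (s / l) powr l * (t / (1 - l)) powr (1 - l)"

text \<open>With both suprema equal to 1, the superlevel sets of \<open>f\<close> and
  \<open>g\<close> are nonempty at every level in \<open>(0, 1)\<close> and empty from 1 on, so
  \<open>brunn_minkowski_real\<close> applies level by level. Integrating over the levels gives a
  bound that is additive in \<open>f\<close> and \<open>g\<close>.\<close>

lemma prekopa_leindler_normalized:
  fixes f g h :: "real \<Rightarrow> real"
  assumes st: "s > 0" "t > 0"
    and [measurable]: "f \<in> borel_measurable borel" "g \<in> borel_measurable borel" "h \<in> borel_measurable borel"
    and nn: "\<And>x. 0 \<le> f x" "\<And>x. 0 \<le> g x" "\<And>x. 0 \<le> h x"
    and le1: "\<And>x. f x \<le> 1" "\<And>x. g x \<le> 1"
    and supp: "\<And>x. f x \<noteq> 0 \<Longrightarrow> \<bar>x\<bar> \<le> L" "\<And>x. g x \<noteq> 0 \<Longrightarrow> \<bar>x\<bar> \<le> L"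
    and sup1: "\<And>u. u < 1 \<Longrightarrow> \<exists>x. u < f x" "\<And>u. u < 1 \<Longrightarrow> \<exists>x. u < g x"
    and level: "\<And>u x y. 0 < u \<Longrightarrow> u < f x \<Longrightarrow> u < g y \<Longrightarrow> u < h (s * x + t * y)"
  shows "ennreal s * (\<integral>\<^sup>+x. ennreal (f x) \<partial>lborel) + ennreal t * (\<integral>\<^sup>+x. ennreal (g x) \<partial>lborel)
    \<le> (\<integral>\<^sup>+x. ennreal (h x) \<partial>lborel)"
proof -
  have [measurable]: "(\<lambda>u. emeasure lborel {x. u < k x}) \<in> borel_measurable borel"
    if [measurable]: "k \<in> borel_measurable borel" for k :: "real \<Rightarrow> real"
  proof -
    have "(\<lambda>u. \<integral>\<^sup>+x. indicator {(u, x). u < k x} (u, x) \<partial>lborel) \<in> borel_measurable borel"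
      by measurable
    also have "(\<lambda>u. \<integral>\<^sup>+x. indicator {(u, x). u < k x} (u, x) \<partial>lborel) = (\<lambda>u. emeasure lborel {x. u < k x})"
    proof
      fix u
      have "(\<integral>\<^sup>+x. indicator {(u, x). u < k x} (u, x) \<partial>lborel) = (\<integral>\<^sup>+x. indicator {x. u < k x} x \<partial>lborel)"
        by (intro nn_integral_cong) (auto simp: indicator_def)
      then show "(\<integral>\<^sup>+x. indicator {(u, x). u < k x} (u, x) \<partial>lborel) = emeasure lborel {x. u < k x}"
        by simp
    qed
    finally show ?thesis .
  qed
  have "ennreal s * (\<integral>\<^sup>+x. ennreal (f x) \<partial>lborel) + ennreal t * (\<integral>\<^sup>+x. ennreal (g x) \<partial>lborel)
    = (\<integral>\<^sup>+u. ennreal s * (indicator {0<..} u * emeasure lborel {x. u < f x})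
        + ennreal t * (indicator {0<..} u * emeasure lborel {x. u < g x}) \<partial>lborel)"
    by (simp add: layer_cake nn nn_integral_add nn_integral_cmult)
  also have "\<dots> \<le> (\<integral>\<^sup>+u. indicator {0<..} u * emeasure lborel {x. u < h x} \<partial>lborel)"
  proof (rule nn_integral_mono)
    fix u :: real
    show "ennreal s * (indicator {0<..} u * emeasure lborel {x. u < f x})
        + ennreal t * (indicator {0<..} u * emeasure lborel {x. u < g x})
        \<le> indicator {0<..} u * emeasure lborel {x. u < h x}"
    proof (cases "0 < u \<and> u < 1")
      case True
      have "ennreal s * emeasure lborel {x. u < f x} + ennreal t * emeasure lborel {x. u < g x}
        \<le> emeasure lborel {x. u < h x}"
      proof (rule brunn_minkowski_real[OF st, where L=L])
        have "\<bar>x\<bar> \<le> L" if "u < f x \<or> u < g x" for x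
          using supp[of x] that True by linarith
        then show "{x. u < f x} \<subseteq> {- L..L}" "{x. u < g x} \<subseteq> {- L..L}"
          by (auto simp: abs_le_iff minus_le_iff)
      qed (use True sup1 level in auto)
      then show ?thesis using True by simp
    next
      case False
      then consider "u \<le> 0" | "1 \<le> u" by linarith
      then show ?thesis
      proof cases
        case 2
        then have "{x. u < f x} = {}" "{x. u < g x} = {}"
          using le1 by (auto simp: not_less intro: order_trans[of _ 1])
        then show ?thesis by simp
      qed simp
    qed
  qed
  also have "\<dots> = (\<integral>\<^sup>+x. ennreal (h x) \<partial>lborel)"
    by (simp add: layer_cake nn)
  finally show ?thesis .
qed

lemma weighted_am_gm:
  fixes l s t X Y :: real
  assumes "0 < l" "l < 1" "s > 0" "t > 0" "X \<ge> 0" "Y \<ge> 0"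
  shows "pl_const l s t * X powr l * Y powr (1 - l) \<le> s * X + t * Y"
proof (cases "X = 0 \<or> Y = 0")
  case True
  then show ?thesis using assms by auto
next
  case False
  then have "(s * X / l) powr l * (t * Y / (1 - l)) powr (1 - l) \<le> l * (s * X / l) + (1 - l) * (t * Y / (1 - l))"
    using assms by (intro Youngs_inequality_0) auto
  moreover have "(s * X / l) powr l = (s / l) powr l * X powr l"
    using assms by (subst powr_mult[symmetric]) (auto simp: field_simps)
  moreover have "(t * Y / (1 - l)) powr (1 - l) = (t / (1 - l)) powr (1 - l) * Y powr (1 - l)"
    using assms by (subst powr_mult[symmetric]) (auto simp: field_simps)
  ultimately show ?thesis using assms by (simp add: pl_const_def mult_ac)
qed

text \<open>Dividing \<open>f\<close> and \<open>g\<close> by their suprema and \<open>h\<close> by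
  the matching \<open>k\<close> reduces this to the normalised case, whose additive bound
  \<open>weighted_am_gm\<close> turns into a geometric mean. The factor \<open>c\<close> is carried
  along for the induction on the dimension.\<close>

lemma prekopa_leindler_real:
  fixes f g h :: "real \<Rightarrow> real"
  assumes st: "s > 0" "t > 0" and l: "0 < l" "l < 1" and c: "c > 0"
    and f: "bounded_compact f" and g: "bounded_compact g" and h: "bounded_compact h"
    and le: "\<And>x y. c * f x powr l * g y powr (1 - l) \<le> h (s * x + t * y)"
  shows "c * pl_const l s t * integral\<^sup>L lborel f powr l * integral\<^sup>L lborel g powr (1 - l)
    \<le> integral\<^sup>L lborel h"
proof -
  note int = bounded_compact_integrable[OF f] bounded_compact_integrable[OF g] bounded_compact_integrable[OF h]
  from f obtain Lf where [measurable]: "f \<in> borel_measurable borel"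
    and Lf: "\<And>x. 0 \<le> f x \<and> f x \<le> Lf \<and> (f x \<noteq> 0 \<longrightarrow> \<bar>x\<bar> \<le> Lf)"
    unfolding bounded_compact_def by auto
  from g obtain Lg where [measurable]: "g \<in> borel_measurable borel"
    and Lg: "\<And>x. 0 \<le> g x \<and> g x \<le> Lg \<and> (g x \<noteq> 0 \<longrightarrow> \<bar>x\<bar> \<le> Lg)"
    unfolding bounded_compact_def by auto
  from h have [measurable]: "h \<in> borel_measurable borel" and hnn: "\<And>x. 0 \<le> h x"
    unfolding bounded_compact_def by auto
  have I0: "0 \<le> integral\<^sup>L lborel h" using hnn by simp
  show ?thesis
  proof (cases "(\<exists>x. f x \<noteq> 0) \<and> (\<exists>y. g y \<noteq> 0)")
    \<comment> \<open>A zero function has no positive supremum to divide by, but its integral makes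
      the left side vanish.\<close>
    case False
    then have "f = (\<lambda>_. 0) \<or> g = (\<lambda>_. 0)" by auto
    then have "integral\<^sup>L lborel f = 0 \<or> integral\<^sup>L lborel g = 0" by auto
    then show ?thesis using I0 l by auto
  next
    case True
    then obtain x0 y0 where x0: "f x0 \<noteq> 0" and y0: "g y0 \<noteq> 0" by auto
    define a where "a = Sup (range f)"
    define b where "b = Sup (range g)"
    have bf: "bdd_above (range f)" and bg: "bdd_above (range g)" using Lf Lg by (auto simp: bdd_above_def)
    have fa: "f x \<le> a" for x unfolding a_def using bf by (intro cSup_upper) auto
    have gb: "g x \<le> b" for x unfolding b_def using bg by (intro cSup_upper) auto
    have a: "a > 0" using fa[of x0] Lf[of x0] x0 by linarith
    have b: "b > 0" using gb[of y0] Lg[of y0] y0 by linarith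
    define k where "k = c * a powr l * b powr (1 - l)"
    have k: "k > 0" using a b c by (simp add: k_def)
    have "ennreal s * (\<integral>\<^sup>+x. ennreal (f x / a) \<partial>lborel) + ennreal t * (\<integral>\<^sup>+x. ennreal (g x / b) \<partial>lborel)
      \<le> (\<integral>\<^sup>+x. ennreal (h x / k) \<partial>lborel)"
    proof (rule prekopa_leindler_normalized[OF st, where L="max Lf Lg"])
      fix u :: real assume u: "u < 1"
      then have "u * a < a" "u * b < b" using a b by auto
      then obtain x y where "u * a < f x" "u * b < g y"
        unfolding a_def b_def using less_cSup_iff[OF _ bf] less_cSup_iff[OF _ bg] by blast
      then have "u < f x / a" "u < g y / b" using a b by (simp_all add: field_simps)
      then show "\<exists>x. u < f x / a" "\<exists>y. u < g y / b" by blast+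
    next
      fix u x y assume u: "0 < u" "u < f x / a" "u < g y / b"
      have "u = u powr l * u powr (1 - l)" using u(1) by (simp add: powr_add[symmetric])
      also have "\<dots> < (f x / a) powr l * (g y / b) powr (1 - l)"
        using u l by (intro mult_strict_mono powr_less_mono2) auto
      also have "\<dots> = c * f x powr l * g y powr (1 - l) / k"
        using Lf Lg a b c by (simp add: powr_divide k_def)
      also have "\<dots> \<le> h (s * x + t * y) / k" using le k by (intro divide_right_mono) auto
      finally show "u < h (s * x + t * y) / k" .
    qed (use a b k Lf Lg fa gb hnn in \<open>auto simp: le_max_iff_disj\<close>)
    also have "(\<integral>\<^sup>+x. ennreal (f x / a) \<partial>lborel) = ennreal (integral\<^sup>L lborel f / a)"
      using int Lf a by (subst nn_integral_eq_integral) auto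
    also have "(\<integral>\<^sup>+x. ennreal (g x / b) \<partial>lborel) = ennreal (integral\<^sup>L lborel g / b)"
      using int Lg b by (subst nn_integral_eq_integral) auto
    also have "(\<integral>\<^sup>+x. ennreal (h x / k) \<partial>lborel) = ennreal (integral\<^sup>L lborel h / k)"
      using int hnn k by (subst nn_integral_eq_integral) auto
    finally have *: "s * (integral\<^sup>L lborel f / a) + t * (integral\<^sup>L lborel g / b) \<le> integral\<^sup>L lborel h / k"
      using st a b k Lf Lg I0
      by (simp add: ennreal_mult'[symmetric] ennreal_plus[symmetric] integral_nonneg_AE del: ennreal_plus)
    have F0: "0 \<le> integral\<^sup>L lborel f" "0 \<le> integral\<^sup>L lborel g" using Lf Lg by auto
    have "pl_const l s t * (integral\<^sup>L lborel f / a) powr l * (integral\<^sup>L lborel g / b) powr (1 - l)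
       \<le> integral\<^sup>L lborel h / k"
      by (rule order_trans[OF weighted_am_gm *]) (use st l a b F0 in auto)
    then have "pl_const l s t * (integral\<^sup>L lborel f / a) powr l * (integral\<^sup>L lborel g / b) powr (1 - l) * k
       \<le> integral\<^sup>L lborel h" using k by (simp add: field_simps)
    then show ?thesis using a b F0 by (simp add: powr_divide k_def mult_ac)
  qed
qed

section \<open>The inequality in dimension \<open>n\<close>, by integrating out coordinates\<close>

abbreviation Leb :: "nat \<Rightarrow> (nat \<Rightarrow> real) measure" where
  "Leb n \<equiv> \<Pi>\<^sub>M i\<in>{..<n}. lborel"

text \<open>Chosen to be stable under freezing all coordinates but the last and under integrating
  the last one out, which is what the induction on \<open>n\<close> needs.\<close>

definition box_bounded :: "nat \<Rightarrow> ((nat \<Rightarrow> real) \<Rightarrow> real) \<Rightarrow> bool" where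
  "box_bounded n f \<longleftrightarrow> f \<in> borel_measurable (Leb n) \<and>
     (\<exists>L. \<forall>x\<in>space (Leb n). 0 \<le> f x \<and> f x \<le> L \<and> (f x \<noteq> 0 \<longrightarrow> (\<forall>i<n. \<bar>x i\<bar> \<le> L)))"

lemma box_bounded_integrable:
  assumes "box_bounded n f"
  shows "integrable (Leb n) f"
proof -
  interpret product_sigma_finite "\<lambda>_::nat. lborel :: real measure" by standard
  from assms obtain L where [measurable]: "f \<in> borel_measurable (Leb n)"
    and L: "\<And>x. x \<in> space (Leb n) \<Longrightarrow> 0 \<le> f x \<and> f x \<le> L \<and> (f x \<noteq> 0 \<longrightarrow> (\<forall>i<n. \<bar>x i\<bar> \<le> L))"
    unfolding box_bounded_def by blast
  let ?B = "\<Pi>\<^sub>E i\<in>{..<n}. {-L..L}"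
  show ?thesis
  proof (rule Bochner_Integration.integrable_bound)
    have "emeasure (Leb n) ?B < \<infinity>"
      by (subst emeasure_PiM)
        (auto simp: emeasure_lborel_Icc_eq ennreal_power less_top[symmetric])
    then show "integrable (Leb n) (\<lambda>x. L * indicator ?B x)"
      by (intro integrable_mult_right integrable_real_indicator sets_PiM_I_finite) auto
    show "AE x in Leb n. norm (f x) \<le> norm (L * indicator ?B x)"
    proof (rule AE_I2)
      fix x assume x: "x \<in> space (Leb n)"
      show "norm (f x) \<le> norm (L * indicator ?B x)"
      proof (cases "f x = 0")
        case False
        then have "x \<in> ?B" using L[OF x] x by (auto simp: space_PiM PiE_iff abs_le_iff minus_le_iff)
        then show ?thesis using L[OF x] by simp
      qed simp
    qed
  qed simp
qed

lemma space_Leb_update: "x \<in> space (Leb n) \<Longrightarrow> x(n := y) \<in> space (Leb (Suc n))"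
  by (auto simp: space_PiM PiE_iff extensional_def)

lemma box_bounded_section:
  assumes "box_bounded (Suc n) f" "x \<in> space (Leb n)"
  shows "bounded_compact (\<lambda>y. f (x(n := y)))"
proof -
  from assms obtain L where [measurable]: "f \<in> borel_measurable (Leb (Suc n))"
    and L: "\<And>x. x \<in> space (Leb (Suc n)) \<Longrightarrow> 0 \<le> f x \<and> f x \<le> L \<and> (f x \<noteq> 0 \<longrightarrow> (\<forall>i<Suc n. \<bar>x i\<bar> \<le> L))"
    unfolding box_bounded_def by blast
  have "(\<lambda>y. x(n := y)) \<in> lborel \<rightarrow>\<^sub>M Leb (Suc n)"
    using measurable_component_update[OF assms(2), of n] by (simp add: lessThan_Suc)
  then have "(\<lambda>y. f (x(n := y))) \<in> borel_measurable borel"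
    using measurable_compose[of "\<lambda>y. x(n := y)" lborel "Leb (Suc n)" f borel] by simp
  then show ?thesis
    unfolding bounded_compact_def using L[OF space_Leb_update[OF assms(2)]] by fastforce
qed

lemma box_bounded_marginal:
  assumes "box_bounded (Suc n) f"
  shows "box_bounded n (\<lambda>x. \<integral>y. f (x(n := y)) \<partial>lborel)"
proof -
  from assms obtain L where f [measurable]: "f \<in> borel_measurable (Leb (Suc n))"
    and L: "\<And>x. x \<in> space (Leb (Suc n)) \<Longrightarrow> 0 \<le> f x \<and> f x \<le> L \<and> (f x \<noteq> 0 \<longrightarrow> (\<forall>i<Suc n. \<bar>x i\<bar> \<le> L))"
    unfolding box_bounded_def by blast
  have "(\<lambda>_\<in>{..<Suc n}. 0) \<in> space (Leb (Suc n))" by (auto simp: space_PiM)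
  from L[OF this] have L0: "0 \<le> L" by linarith
  have "(\<lambda>(x, y). x(n := y)) \<in> Leb n \<Otimes>\<^sub>M lborel \<rightarrow>\<^sub>M Leb (Suc n)"
    using measurable_add_dim[of n "{..<n}" "\<lambda>_. lborel"] by (simp add: lessThan_Suc)
  from measurable_compose[OF this f]
  have "(\<lambda>(x, y). f (x(n := y))) \<in> borel_measurable (Leb n \<Otimes>\<^sub>M lborel)"
    by (simp add: case_prod_beta')
  then have meas: "(\<lambda>x. \<integral>y. f (x(n := y)) \<partial>lborel) \<in> borel_measurable (Leb n)"
    by (intro lborel.borel_measurable_lebesgue_integral)
  \<comment> \<open>The integral is at most \<open>2 * L * L\<close> and the support stays within
    \<open>L\<close>; the sum serves as one bound for both.\<close>
  have "0 \<le> (\<integral>y. f (x(n := y)) \<partial>lborel) \<and> (\<integral>y. f (x(n := y)) \<partial>lborel) \<le> L + 2 * L * L \<and>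
      ((\<integral>y. f (x(n := y)) \<partial>lborel) \<noteq> 0 \<longrightarrow> (\<forall>i<n. \<bar>x i\<bar> \<le> L + 2 * L * L))"
    if x: "x \<in> space (Leb n)" for x
  proof (intro conjI impI)
    note Lx = L[OF space_Leb_update[OF x]]
    show "0 \<le> (\<integral>y. f (x(n := y)) \<partial>lborel)" using Lx by (intro integral_nonneg_AE) auto
    have "(\<integral>y. f (x(n := y)) \<partial>lborel) \<le> (\<integral>y. L * indicator {-L..L} y \<partial>lborel)"
    proof (rule integral_mono)
      show "integrable lborel (\<lambda>y. f (x(n := y)))"
        by (rule bounded_compact_integrable[OF box_bounded_section[OF assms x]])
      show "integrable lborel (\<lambda>x. L * indicator {-L..L} x)"
        by (intro integrable_mult_right integrable_real_indicator) (auto simp: emeasure_lborel_Icc_eq)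
      fix y
      have "f (x(n := y)) \<noteq> 0 \<Longrightarrow> \<bar>y\<bar> \<le> L" using Lx[of y] by auto
      then show "f (x(n := y)) \<le> L * indicator {- L..L} y" using Lx[of y]
        by (auto simp: indicator_def abs_le_iff minus_le_iff)
    qed
    also have "\<dots> = 2 * L * L" using L0 by simp
    finally show "(\<integral>y. f (x(n := y)) \<partial>lborel) \<le> L + 2 * L * L" using L0 by linarith
    assume "(\<integral>y. f (x(n := y)) \<partial>lborel) \<noteq> 0"
    then have "(\<lambda>y. f (x(n := y))) \<noteq> (\<lambda>_. 0)" by auto
    then obtain y where "f (x(n := y)) \<noteq> 0" by auto
    then have "\<forall>i<Suc n. \<bar>(x(n := y)) i\<bar> \<le> L" using Lx[of y] by blast
    then have "\<forall>i<n. \<bar>x i\<bar> \<le> L" by (metis fun_upd_other less_SucI less_irrefl_nat)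
    moreover have "0 \<le> 2 * L * L" using L0 by simp
    ultimately show "\<forall>i<n. \<bar>x i\<bar> \<le> L + 2 * L * L" by (auto intro: add_increasing2)
  qed
  with meas show ?thesis unfolding box_bounded_def by blast
qed

lemma box_bounded_integral_Suc:
  assumes "box_bounded (Suc n) f"
  shows "integral\<^sup>L (Leb (Suc n)) f = (\<integral>x. (\<integral>y. f (x(n := y)) \<partial>lborel) \<partial>Leb n)"
proof -
  interpret product_sigma_finite "\<lambda>_::nat. lborel :: real measure" by standard
  show ?thesis
    using product_integral_insert[of "{..<n}" n f] box_bounded_integrable[OF assms]
    by (simp add: lessThan_Suc)
qed

text \<open>The one-dimensional case in the last coordinate shows that the marginals satisfy the
  hypothesis with \<open>c * pl_const l s t\<close> in place of \<open>c\<close>. The point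
  \<open>z\<close> is a variable constrained on the index set because the pointwise combination of
  two extensional functions is not extensional.\<close>

theorem prekopa_leindler:
  assumes st: "s > 0" "t > 0" and l: "0 < l" "l < 1" and c: "c > 0"
    and f: "box_bounded n f" and g: "box_bounded n g" and h: "box_bounded n h"
    and le: "\<And>x y z. x \<in> space (Leb n) \<Longrightarrow> y \<in> space (Leb n) \<Longrightarrow> z \<in> space (Leb n) \<Longrightarrow>
      (\<And>i. i < n \<Longrightarrow> z i = s * x i + t * y i) \<Longrightarrow> c * f x powr l * g y powr (1 - l) \<le> h z"
  shows "c * pl_const l s t ^ n * integral\<^sup>L (Leb n) f powr l * integral\<^sup>L (Leb n) g powr (1 - l)
    \<le> integral\<^sup>L (Leb n) h"
  using c f g h le
proof (induction n arbitrary: c f g h)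
  case 0
  \<comment> \<open>\<open>Leb 0\<close> is the unit mass at the empty vector, so the claim is the
    hypothesis at that point.\<close>
  have "integral\<^sup>L (Leb 0) k = k (\<lambda>_. undefined)" for k :: "(nat \<Rightarrow> real) \<Rightarrow> real"
    by (simp add: PiM_empty lebesgue_integral_count_space_finite)
  moreover have "c * f (\<lambda>_. undefined) powr l * g (\<lambda>_. undefined) powr (1 - l) \<le> h (\<lambda>_. undefined)"
    by (rule 0(5)) (auto simp: space_PiM)
  ultimately show ?case by simp
next
  case (Suc n)
  let ?K = "pl_const l s t"
  have K: "?K > 0" using st l by (simp add: pl_const_def)
  let ?m = "\<lambda>k x. \<integral>y. k (x(n := y)) \<partial>lborel"
  have "(c * ?K) * ?K ^ n * integral\<^sup>L (Leb n) (?m f) powr l * integral\<^sup>L (Leb n) (?m g) powr (1 - l)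
    \<le> integral\<^sup>L (Leb n) (?m h)"
  proof (rule Suc.IH)
    show "0 < c * ?K" using K Suc.prems by simp
    show "box_bounded n (?m f)" "box_bounded n (?m g)" "box_bounded n (?m h)"
      by (intro box_bounded_marginal Suc.prems)+
    fix x y z assume xyz: "x \<in> space (Leb n)" "y \<in> space (Leb n)" "z \<in> space (Leb n)"
      and z: "\<And>i. i < n \<Longrightarrow> z i = s * x i + t * y i"
    show "c * ?K * ?m f x powr l * ?m g y powr (1 - l) \<le> ?m h z"
    proof (rule prekopa_leindler_real[OF st l Suc.prems(1)])
      fix a b
      show "c * f (x(n := a)) powr l * g (y(n := b)) powr (1 - l) \<le> h (z(n := s * a + t * b))"
        by (rule Suc.prems(5)[OF xyz[THEN space_Leb_update]]) (auto simp: z less_Suc_eq)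
    qed (intro box_bounded_section Suc.prems xyz)+
  qed
  then show ?case
    by (simp add: box_bounded_integral_Suc Suc.prems mult_ac)
qed

section \<open>Products of Gaussian measures\<close>

lemma sets_gaussian [simp, measurable_cong]: "sets (gaussian m s) = sets borel"
  by (simp add: gaussian_def)

lemma space_gaussian [simp]: "space (gaussian m s) = UNIV"
  by (simp add: gaussian_def)

lemma prob_space_gaussian: "s > 0 \<Longrightarrow> prob_space (gaussian m s)"
  unfolding gaussian_def by (rule prob_space_normal_density)

lemma
  assumes "s > 0"
  shows integrable_gaussian_moment: "integrable (gaussian m s) (\<lambda>x. (x - m) ^ k)"
    and gaussian_moment_eq: "integral\<^sup>L (gaussian m s) (\<lambda>x. (x - m) ^ k) = (\<integral>x. normal_density m s x * (x - m) ^ k \<partial>lborel)"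
  unfolding gaussian_def using assms
  by (simp_all add: integrable_density integral_density integrable_normal_moment)

lemma gaussian_moments:
  assumes "s > 0"
  shows "(\<integral>x. x - m \<partial>gaussian m s) = 0"
    and "(\<integral>x. (x - m)\<^sup>2 \<partial>gaussian m s) = s\<^sup>2"
    and "(\<integral>x. (x - m) ^ 4 \<partial>gaussian m s) = 3 * s ^ 4"
  using gaussian_moment_eq[OF assms, of m 1] gaussian_moment_eq[OF assms, of m 2]
    gaussian_moment_eq[OF assms, of m 4]
    integral_normal_moment_odd[OF assms, of m 0]
    integral_normal_moment_even[OF assms, of m 1] integral_normal_moment_even[OF assms, of m 2]
  by (simp_all add: fact_numeral power_divide eval_nat_numeral)

text \<open>The means may vary with the coordinate because the covering argument uses a Gaussian
  centred near a given vector.\<close>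

abbreviation gprod :: "nat \<Rightarrow> (nat \<Rightarrow> real) \<Rightarrow> real \<Rightarrow> (nat \<Rightarrow> real) measure" where
  "gprod n m s \<equiv> \<Pi>\<^sub>M i\<in>{..<n}. gaussian (m i) s"

definition sqd :: "nat \<Rightarrow> (nat \<Rightarrow> real) \<Rightarrow> (nat \<Rightarrow> real) \<Rightarrow> real" where
  "sqd n m x = (\<Sum>i<n. (x i - m i)\<^sup>2)"

lemma sqd_nonneg: "0 \<le> sqd n m x"
  by (simp add: sqd_def sum_nonneg)

lemma sets_gprod: "sets (gprod n m s) = sets (Leb n)"
  by (intro sets_PiM_cong) auto

lemma space_gprod: "space (gprod n m s) = space (Leb n)"
  by (simp add: space_PiM)

lemma prob_space_gprod: "s > 0 \<Longrightarrow> prob_space (gprod n m s)"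
  by (intro prob_space_PiM prob_space_gaussian)

lemma sqd_measurable [measurable]: "sqd n m \<in> borel_measurable (Leb n)"
  unfolding sqd_def by measurable

lemma gprod_density:
  assumes s: "s > 0"
  shows "gprod n m s = density (Leb n)
    (\<lambda>x. ennreal ((1 / sqrt (2 * pi * s\<^sup>2)) ^ n * exp (- sqd n m x / (2 * s\<^sup>2))))"
proof -
  interpret L: product_sigma_finite "\<lambda>_::nat. lborel :: real measure" by standard
  interpret G: product_sigma_finite "\<lambda>i. gaussian (m i) s"
    using prob_space_gaussian[OF s] prob_space_imp_sigma_finite
    by (auto intro!: product_sigma_finite.intro)
  have F: "ennreal ((1 / sqrt (2 * pi * s\<^sup>2)) ^ n * exp (- sqd n m x / (2 * s\<^sup>2)))
      = (\<Prod>i<n. ennreal (normal_density (m i) s (x i)))" for x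
  proof -
    have "(\<Prod>i<n. normal_density (m i) s (x i))
      = (1 / sqrt (2 * pi * s\<^sup>2)) ^ n * exp (\<Sum>i<n. -(x i - m i)\<^sup>2 / (2 * s\<^sup>2))"
      by (simp add: normal_density_def prod_dividef exp_sum power_divide prod.distrib)
    also have "(\<Sum>i<n. -(x i - m i)\<^sup>2 / (2 * s\<^sup>2)) = - sqd n m x / (2 * s\<^sup>2)"
      by (simp add: sqd_def sum_divide_distrib sum_negf)
    finally show ?thesis by (simp add: prod_ennreal)
  qed
  have "density (Leb n) (\<lambda>x. \<Prod>i<n. ennreal (normal_density (m i) s (x i))) = gprod n m s"
  proof (rule G.PiM_eqI)
    show "sets (density (Leb n) (\<lambda>x. \<Prod>i<n. ennreal (normal_density (m i) s (x i)))) = sets (gprod n m s)"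
      by (simp add: sets_gprod)
    fix A :: "nat \<Rightarrow> real set" assume "\<And>i. i \<in> {..<n} \<Longrightarrow> A i \<in> sets (gaussian (m i) s)"
    then have A: "\<And>i. i < n \<Longrightarrow> A i \<in> sets borel" by simp
    have "emeasure (density (Leb n) (\<lambda>x. \<Prod>i<n. ennreal (normal_density (m i) s (x i)))) (Pi\<^sub>E {..<n} A)
      = (\<integral>\<^sup>+x. (\<Prod>i<n. ennreal (normal_density (m i) s (x i))) * indicator (Pi\<^sub>E {..<n} A) x \<partial>Leb n)"
      using A by (intro emeasure_density sets_PiM_I_finite) (auto intro!: borel_measurable_prod_ennreal)
    also have "\<dots> = (\<integral>\<^sup>+x. (\<Prod>i<n. ennreal (normal_density (m i) s (x i)) * indicator (A i) (x i)) \<partial>Leb n)"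
    proof (rule nn_integral_cong)
      fix x assume x: "x \<in> space (Leb n)"
      have "(indicator (Pi\<^sub>E {..<n} A) x :: ennreal) = (\<Prod>i<n. indicator (A i) (x i))"
      proof (cases "\<forall>i<n. x i \<in> A i")
        case True
        then have "x \<in> Pi\<^sub>E {..<n} A" using x by (auto simp: space_PiM PiE_iff)
        then show ?thesis using True by simp
      next
        case False
        then obtain i where "i < n" "x i \<notin> A i" by auto
        then have "(\<Prod>i<n. indicator (A i) (x i)) = (0::ennreal)"
          by (intro prod_zero bexI[of _ i]) auto
        moreover have "x \<notin> Pi\<^sub>E {..<n} A" using \<open>i < n\<close> \<open>x i \<notin> A i\<close> by auto
        ultimately show ?thesis by simp
      qed
      then show "(\<Prod>i<n. ennreal (normal_density (m i) s (x i))) * indicator (Pi\<^sub>E {..<n} A) x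
        = (\<Prod>i<n. ennreal (normal_density (m i) s (x i)) * indicator (A i) (x i))"
        by (simp add: prod.distrib)
    qed
    also have "\<dots> = (\<Prod>i<n. \<integral>\<^sup>+x. ennreal (normal_density (m i) s x) * indicator (A i) x \<partial>lborel)"
      using A by (intro L.product_nn_integral_prod) auto
    also have "\<dots> = (\<Prod>i<n. emeasure (gaussian (m i) s) (A i))"
      using A by (intro prod.cong) (auto simp: gaussian_def emeasure_density)
    finally show "emeasure (density (Leb n) (\<lambda>x. \<Prod>i<n. ennreal (normal_density (m i) s (x i)))) (Pi\<^sub>E {..<n} A)
      = (\<Prod>i<n. emeasure (gaussian (m i) s) (A i))" .
  qed simp
  then show ?thesis unfolding F by simp
qed

text \<open>The density at squared distance \<open>real n * s\<^sup>2 * k\<close> from the mean,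
  written as an \<open>n\<close>-th power so that probabilities and volumes can be compared through
  their bases.\<close>

lemma gprod_density_const:
  assumes "s > 0"
  shows "(1 / sqrt (2 * pi * s\<^sup>2)) ^ n * exp (- (real n * s\<^sup>2 * k) / (2 * s\<^sup>2))
    = (exp (- k / 2) / (sqrt (2 * pi) * s)) ^ n"
proof -
  have "exp (- (real n * s\<^sup>2 * k) / (2 * s\<^sup>2)) = exp (real n * (- k / 2))"
    using assms by (simp add: field_simps)
  also have "\<dots> = exp (- k / 2) ^ n" by (rule exp_of_nat_mult)
  finally show ?thesis using assms
    by (simp add: power_divide real_sqrt_mult power_mult_distrib)
qed

text \<open>Far from the mean the density is at most the constant of
  \<open>gprod_density_const\<close>. With \<open>k\<close> close to 1 the estimate matches
  \<open>volume_ball_le\<close> to exponential order.\<close>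

lemma gprod_le_volume:
  assumes s: "s > 0" and A: "A \<in> sets (Leb n)" and far: "\<And>x. x \<in> A \<Longrightarrow> real n * s\<^sup>2 * k \<le> sqd n m x"
  shows "emeasure (gprod n m s) A \<le> ennreal ((exp (- k / 2) / (sqrt (2 * pi) * s)) ^ n) * emeasure (Leb n) A"
proof -
  have "emeasure (gprod n m s) A
      = (\<integral>\<^sup>+x. ennreal ((1 / sqrt (2 * pi * s\<^sup>2)) ^ n * exp (- sqd n m x / (2 * s\<^sup>2))) * indicator A x \<partial>Leb n)"
    using A unfolding gprod_density[OF s] by (intro emeasure_density) auto
  also have "\<dots> \<le> (\<integral>\<^sup>+x. ennreal ((exp (- k / 2) / (sqrt (2 * pi) * s)) ^ n) * indicator A x \<partial>Leb n)"
    unfolding gprod_density_const[OF s, symmetric]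
    using far s
    by (intro nn_integral_mono) (auto simp: indicator_def divide_simps mult_ac intro!: ennreal_leI mult_left_mono)
  also have "\<dots> = ennreal ((exp (- k / 2) / (sqrt (2 * pi) * s)) ^ n) * emeasure (Leb n) A"
    using A by (simp add: nn_integral_cmult)
  finally show ?thesis .
qed

text \<open>The Gaussian itself supplies the bound: on this ball its density is at least
  \<open>(exp (- 1 / 2) / (sqrt (2 * pi) * s)) ^ n\<close>, and its total mass is at most 1.\<close>

lemma volume_ball_le:
  assumes s: "s > 0"
  shows "emeasure (Leb n) {x \<in> space (Leb n). sqd n m x \<le> real n * s\<^sup>2}
    \<le> ennreal ((exp (1 / 2) * (sqrt (2 * pi) * s)) ^ n)"
proof -
  let ?B = "{x \<in> space (Leb n). sqd n m x \<le> real n * s\<^sup>2}"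
  let ?c = "(exp (- 1 / 2) / (sqrt (2 * pi) * s)) ^ n" and ?d = "(exp (1 / 2) * (sqrt (2 * pi) * s)) ^ n"
  have B [measurable]: "?B \<in> sets (Leb n)" by measurable
  have "ennreal ?c * emeasure (Leb n) ?B
    = (\<integral>\<^sup>+x. ennreal ((exp (- 1 / 2) / (sqrt (2 * pi) * s)) ^ n) * indicator ?B x \<partial>Leb n)"
    by (simp add: nn_integral_cmult)
  also have "\<dots> \<le> (\<integral>\<^sup>+x. ennreal ((1 / sqrt (2 * pi * s\<^sup>2)) ^ n * exp (- sqd n m x / (2 * s\<^sup>2))) * indicator ?B x \<partial>Leb n)"
    unfolding gprod_density_const[OF s, symmetric]
    using s
    by (intro nn_integral_mono) (auto simp: indicator_def divide_simps mult_ac intro!: ennreal_leI mult_left_mono)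
  also have "\<dots> = emeasure (gprod n m s) ?B"
    using B unfolding gprod_density[OF s] by (intro emeasure_density[symmetric]) auto
  also have "\<dots> \<le> 1"
    using prob_space.emeasure_le_1[OF prob_space_gprod[OF s]] by simp
  finally have "ennreal ?d * (ennreal ?c * emeasure (Leb n) ?B) \<le> ennreal ?d * 1"
    by (intro mult_left_mono) auto
  moreover have "ennreal ?d * ennreal ?c = 1"
    using s by (simp add: ennreal_mult'[symmetric] power_mult_distrib[symmetric] exp_minus)
  ultimately show ?thesis by (simp add: mult.assoc[symmetric])
qed

section \<open>Second moments and Chebyshev bounds for sums of independent terms\<close>

lemma PiM_second_moment:
  fixes f :: "nat \<Rightarrow> real \<Rightarrow> real"
  assumes M: "\<And>i. prob_space (M i)"
    and f1: "\<And>i. integrable (M i) (f i)" and f2: "\<And>i. integrable (M i) (\<lambda>x. (f i x)\<^sup>2)"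
    and f0: "\<And>i. integral\<^sup>L (M i) (f i) = 0"
  shows "integrable (PiM {..<n} M) (\<lambda>x. (\<Sum>i<n. f i (x i))\<^sup>2)"
    and "(\<integral>x. (\<Sum>i<n. f i (x i))\<^sup>2 \<partial>PiM {..<n} M) = (\<Sum>i<n. \<integral>x. (f i x)\<^sup>2 \<partial>M i)"
proof -
  interpret product_sigma_finite M
    using M prob_space_imp_sigma_finite by (auto intro!: product_sigma_finite.intro)
  interpret M: prob_space "M i" for i by (rule M)
  have sq: "(\<Sum>i<n. f i (x i))\<^sup>2 = (\<Sum>i<n. \<Sum>j<n. f i (x i) * f j (x j))" for x
    by (simp add: power2_eq_square sum_product)
  \<comment> \<open>\<open>?h i j k\<close> is the factor that coordinate \<open>k\<close>
    contributes to \<open>f i * f j\<close>; two separate conditionals give the square when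
    \<open>i = j\<close>. Off the diagonal the factor at \<open>k = i\<close> integrates to 0, so
    only the squares survive.\<close>
  let ?h = "\<lambda>i j k y. (if k = i then f i y else 1) * (if k = j then f j y else 1)"
  have h: "f i (x i) * f j (x j) = (\<Prod>k<n. ?h i j k (x k))" if "i < n" "j < n" for i j x
    using that by (simp add: prod.distrib prod.delta)
  have hi: "integrable (M k) (?h i j k)" for i j k
    using f1 f2 by (cases "k = i"; cases "k = j") (auto simp: power2_eq_square)
  have I: "integrable (PiM {..<n} M) (\<lambda>x. f i (x i) * f j (x j))" if "i < n" "j < n" for i j
    using product_integrable_prod[of "{..<n}" "?h i j"] hi by (simp add: h that)
  have E: "(\<integral>x. f i (x i) * f j (x j) \<partial>PiM {..<n} M) = (if i = j then \<integral>x. (f i x)\<^sup>2 \<partial>M i else 0)"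
    if ij: "i < n" "j < n" for i j
  proof -
    have "(\<integral>x. f i (x i) * f j (x j) \<partial>PiM {..<n} M) = (\<Prod>k<n. integral\<^sup>L (M k) (?h i j k))"
      using product_integral_prod[of "{..<n}" "?h i j"] hi by (simp add: h ij)
    also have "\<dots> = (if i = j then \<integral>x. (f i x)\<^sup>2 \<partial>M i else 0)"
    proof (cases "i = j")
      case True
      have "(\<Prod>k<n. integral\<^sup>L (M k) (?h i j k)) = (\<Prod>k<n. if k = i then \<integral>x. (f i x)\<^sup>2 \<partial>M i else 1)"
        using True by (intro prod.cong) (auto simp: power2_eq_square M.prob_space)
      then show ?thesis using True ij by simp
    next
      case False
      have "integral\<^sup>L (M i) (?h i j i) = 0" using False f0 by simp
      then show ?thesis using False ij by (auto intro!: prod_zero bexI[of _ i])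
    qed
    finally show ?thesis .
  qed
  show "integrable (PiM {..<n} M) (\<lambda>x. (\<Sum>i<n. f i (x i))\<^sup>2)"
    unfolding sq by (intro Bochner_Integration.integrable_sum I) auto
  have "(\<integral>x. (\<Sum>i<n. f i (x i))\<^sup>2 \<partial>PiM {..<n} M)
      = (\<Sum>i<n. \<Sum>j<n. \<integral>x. f i (x i) * f j (x j) \<partial>PiM {..<n} M)"
    unfolding sq using I
    by (subst Bochner_Integration.integral_sum, force)
      (intro sum.cong refl Bochner_Integration.integral_sum, force)
  also have "\<dots> = (\<Sum>i<n. \<Sum>j<n. if i = j then \<integral>x. (f i x)\<^sup>2 \<partial>M i else 0)"
    by (intro sum.cong refl E) auto
  also have "\<dots> = (\<Sum>i<n. \<integral>x. (f i x)\<^sup>2 \<partial>M i)" by simp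
  finally show "(\<integral>x. (\<Sum>i<n. f i (x i))\<^sup>2 \<partial>PiM {..<n} M) = (\<Sum>i<n. \<integral>x. (f i x)\<^sup>2 \<partial>M i)" .
qed

lemma PiM_chebyshev:
  fixes f :: "nat \<Rightarrow> real \<Rightarrow> real"
  assumes M: "\<And>i. prob_space (M i)"
    and f1: "\<And>i. integrable (M i) (f i)" and f2: "\<And>i. integrable (M i) (\<lambda>x. (f i x)\<^sup>2)"
    and f0: "\<And>i. integral\<^sup>L (M i) (f i) = 0" and c: "c > 0"
  shows "measure (PiM {..<n} M) {x \<in> space (PiM {..<n} M). c \<le> \<bar>\<Sum>i<n. f i (x i)\<bar>}
    \<le> (\<Sum>i<n. \<integral>x. (f i x)\<^sup>2 \<partial>M i) / c\<^sup>2"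
proof -
  have "c \<le> \<bar>z\<bar> \<longleftrightarrow> c\<^sup>2 \<le> z\<^sup>2" for z using c by (metis abs_le_square_iff abs_of_pos)
  then have "measure (PiM {..<n} M) {x \<in> space (PiM {..<n} M). c \<le> \<bar>\<Sum>i<n. f i (x i)\<bar>}
    = measure (PiM {..<n} M) {x \<in> space (PiM {..<n} M). c\<^sup>2 \<le> (\<Sum>i<n. f i (x i))\<^sup>2}"
    by simp
  also have "\<dots> \<le> (\<integral>x. (\<Sum>i<n. f i (x i))\<^sup>2 \<partial>PiM {..<n} M) / c\<^sup>2"
    by (rule integral_Markov_inequality_measure[OF PiM_second_moment(1)[OF M f1 f2 f0] sets.top])
      (use c in auto)
  finally show ?thesis by (simp add: PiM_second_moment(2)[OF M f1 f2 f0])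
qed

text \<open>Chebyshev for the squared coordinates, each of variance \<open>2 * s ^ 4\<close> by the
  fourth moment: the mass sits in a shell of relative thickness \<open>e\<close>.\<close>

lemma gprod_shell:
  assumes s: "s > 0" and e: "e > 0" and n: "n > 0"
  shows "measure (gprod n m s) {x \<in> space (Leb n). real n * s\<^sup>2 * e \<le> \<bar>sqd n m x - real n * s\<^sup>2\<bar>}
    \<le> 2 / (real n * e\<^sup>2)"
proof -
  interpret G: prob_space "gaussian (m i) s" for i by (rule prob_space_gaussian[OF s])
  let ?f = "\<lambda>i x. (x - m i)\<^sup>2 - s\<^sup>2"
  have sq: "(?f i x)\<^sup>2 = (x - m i) ^ 4 - 2 * s\<^sup>2 * (x - m i)\<^sup>2 + s ^ 4" for i x
    by (simp add: power2_eq_square eval_nat_numeral algebra_simps)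
  note int [simp] = integrable_gaussian_moment[OF s]
  have 1: "integrable (gaussian (m i) s) (?f i)" for i by simp
  have 2: "integrable (gaussian (m i) s) (\<lambda>x. (?f i x)\<^sup>2)" for i unfolding sq by simp
  have 3: "integral\<^sup>L (gaussian (m i) s) (?f i) = 0" for i
    using G.prob_space[of i] by (simp add: gaussian_moments[OF s])
  have 4: "(\<integral>x. (?f i x)\<^sup>2 \<partial>gaussian (m i) s) = 2 * s ^ 4" for i
  proof -
    have "(\<integral>x. (?f i x)\<^sup>2 \<partial>gaussian (m i) s) = 3 * s ^ 4 - 2 * s\<^sup>2 * s\<^sup>2 + s ^ 4"
      unfolding sq using G.prob_space[of i] by (simp add: gaussian_moments[OF s])
    then show ?thesis by (simp add: power2_eq_square eval_nat_numeral)
  qed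
  have eq: "(\<Sum>i<n. ?f i (x i)) = sqd n m x - real n * s\<^sup>2" for x
    by (simp add: sqd_def sum_subtractf)
  have "measure (gprod n m s) {x \<in> space (gprod n m s). real n * s\<^sup>2 * e \<le> \<bar>\<Sum>i<n. ?f i (x i)\<bar>}
    \<le> (\<Sum>i<n. \<integral>x. (?f i x)\<^sup>2 \<partial>gaussian (m i) s) / (real n * s\<^sup>2 * e)\<^sup>2"
    by (rule PiM_chebyshev[OF prob_space_gaussian[OF s] 1 2 3]) (use s e n in auto)
  also have "\<dots> = real n * (2 * s ^ 4) / (real n * s\<^sup>2 * e)\<^sup>2"
    unfolding 4 by simp
  also have "\<dots> = 2 / (real n * e\<^sup>2)"
    using s e n by (simp add: field_simps eval_nat_numeral)
  finally show ?thesis unfolding eq space_gprod .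
qed

text \<open>Chebyshev for a linear functional: a Gaussian vector is nearly orthogonal to any fixed
  direction \<open>u\<close>.\<close>

lemma gprod_linear:
  assumes s: "s > 0" and c: "c > 0"
  shows "measure (gprod n m s) {x \<in> space (Leb n). c \<le> \<bar>\<Sum>i<n. u i * (x i - m i)\<bar>}
    \<le> s\<^sup>2 * (\<Sum>i<n. (u i)\<^sup>2) / c\<^sup>2"
proof -
  let ?f = "\<lambda>i x. u i * (x - m i)"
  have 1: "integrable (gaussian (m i) s) (?f i)" for i
    using integrable_gaussian_moment[OF s, of "m i" 1] by simp
  have 2: "integrable (gaussian (m i) s) (\<lambda>x. (?f i x)\<^sup>2)" for i
    using integrable_gaussian_moment[OF s, of "m i" 2] by (simp add: power_mult_distrib)
  have 3: "integral\<^sup>L (gaussian (m i) s) (?f i) = 0" for i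
    by (simp add: gaussian_moments[OF s])
  have 4: "(\<integral>x. (?f i x)\<^sup>2 \<partial>gaussian (m i) s) = (u i)\<^sup>2 * s\<^sup>2" for i
    by (simp add: gaussian_moments[OF s] power_mult_distrib)
  have "measure (gprod n m s) {x \<in> space (gprod n m s). c \<le> \<bar>\<Sum>i<n. ?f i (x i)\<bar>}
    \<le> (\<Sum>i<n. \<integral>x. (?f i x)\<^sup>2 \<partial>gaussian (m i) s) / c\<^sup>2"
    by (rule PiM_chebyshev[OF prob_space_gaussian[OF s] 1 2 3 c])
  then show ?thesis by (simp add: 4 space_gprod sum_distrib_left mult.commute)
qed

section \<open>Converse\<close>

lemma sq_le_sqd: "i < n \<Longrightarrow> (x i - m i)\<^sup>2 \<le> sqd n m x"
  unfolding sqd_def by (rule member_le_sum) auto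

lemma box_bounded_indicator:
  assumes A: "A \<in> sets (Leb n)" and c: "\<And>x. x \<in> A \<Longrightarrow> sqd n (\<lambda>_. m) x \<le> c"
  shows "box_bounded n (indicator A)"
proof -
  have "\<bar>x i\<bar> \<le> 1 + \<bar>m\<bar> + sqrt \<bar>c\<bar>" if "x \<in> A" "i < n" for x i
  proof -
    have "(x i - m)\<^sup>2 \<le> \<bar>c\<bar>" using sq_le_sqd[OF that(2), of x "\<lambda>_. m"] c[OF that(1)] by linarith
    then have "\<bar>x i - m\<bar> \<le> sqrt \<bar>c\<bar>" using real_le_rsqrt by fastforce
    then show ?thesis by linarith
  qed
  moreover have "1 \<le> 1 + \<bar>m\<bar> + sqrt \<bar>c\<bar>" by simp
  ultimately show ?thesis
    unfolding box_bounded_def using A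
    by (intro conjI borel_measurable_indicator exI[of _ "1 + \<bar>m\<bar> + sqrt \<bar>c\<bar>"]) (auto simp: indicator_def)
qed

lemma measure_gprod_le_volume:
  assumes s: "s > 0" and A: "A \<in> sets (Leb n)" and fin: "emeasure (Leb n) A \<noteq> \<infinity>"
    and far: "\<And>x. x \<in> A \<Longrightarrow> real n * s\<^sup>2 * k \<le> sqd n m x"
  shows "measure (gprod n m s) A * (exp (k / 2) * (sqrt (2 * pi) * s)) ^ n \<le> measure (Leb n) A"
proof -
  interpret G: prob_space "gprod n m s" by (rule prob_space_gprod[OF s])
  let ?c = "(exp (- k / 2) / (sqrt (2 * pi) * s)) ^ n" and ?d = "(exp (k / 2) * (sqrt (2 * pi) * s)) ^ n"
  have c0: "0 \<le> ?c" and d0: "0 \<le> ?d" using s by auto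
  have "ennreal (measure (gprod n m s) A) \<le> ennreal ?c * ennreal (measure (Leb n) A)"
    using gprod_le_volume[OF s A far] fin by (simp add: G.emeasure_eq_measure emeasure_eq_ennreal_measure)
  also have "\<dots> = ennreal (?c * measure (Leb n) A)"
    using c0 by (rule ennreal_mult'[symmetric])
  finally have "measure (gprod n m s) A \<le> ?c * measure (Leb n) A"
    using c0 by (simp add: ennreal_le_iff)
  then have "measure (gprod n m s) A * ?d \<le> ?c * measure (Leb n) A * ?d"
    using d0 by (rule mult_right_mono)
  also have "\<dots> = (?c * ?d) * measure (Leb n) A" by (simp add: mult_ac)
  also have "?c * ?d = 1" using s by (simp add: power_mult_distrib[symmetric] exp_minus)
  finally show ?thesis by simp
qed

text \<open>The identity \<open>|s x + t y - (s + t) m|^2 = s (s + t) |x - m|^2 + t (s + t) |y -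
  m|^2 - s t |x - y|^2\<close> turns separation into smallness: \<open>s A + t B\<close> lies in a
  ball of squared radius \<open>real n * q\<^sup>2\<close>. The rest is
  \<open>prekopa_leindler\<close> for indicators together with
  \<open>volume_ball_le\<close>.\<close>

lemma separated_sets_volume:
  assumes sig: "\<sigma>X > 0" "\<sigma>Y > 0" and st: "s > 0" "t > 0" and l: "0 < l" "l < 1" and q: "q > 0"
    and A: "A \<in> sets (Leb n)" and B: "B \<in> sets (Leb n)"
    and shA: "\<And>x. x \<in> A \<Longrightarrow> sqd n (\<lambda>_. m) x \<le> real n * \<sigma>X\<^sup>2 * (1 + e)"
    and shB: "\<And>y. y \<in> B \<Longrightarrow> sqd n (\<lambda>_. m) y \<le> real n * \<sigma>Y\<^sup>2 * (1 + e)"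
    and far: "\<And>x y. x \<in> A \<Longrightarrow> y \<in> B \<Longrightarrow> real n * D \<le> sqd n x y"
    and qge: "(1 + e) * (s * (s + t) * \<sigma>X\<^sup>2 + t * (s + t) * \<sigma>Y\<^sup>2) - s * t * D \<le> q\<^sup>2"
  shows "pl_const l s t ^ n * measure (Leb n) A powr l * measure (Leb n) B powr (1 - l)
    \<le> (exp (1 / 2) * (sqrt (2 * pi) * q)) ^ n"
proof -
  let ?C = "{z \<in> space (Leb n). sqd n (\<lambda>_. (s + t) * m) z \<le> real n * q\<^sup>2}"
  have C: "?C \<in> sets (Leb n)" by measurable
  have bb: "box_bounded n (indicator A)" "box_bounded n (indicator B)" "box_bounded n (indicator ?C)"
    using box_bounded_indicator[OF A shA] box_bounded_indicator[OF B shB] box_bounded_indicator[OF C, of "(s + t) * m"]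
    by auto
  have "1 * pl_const l s t ^ n * integral\<^sup>L (Leb n) (indicator A) powr l * integral\<^sup>L (Leb n) (indicator B) powr (1 - l)
    \<le> integral\<^sup>L (Leb n) (indicator ?C)"
  proof (rule prekopa_leindler[OF st l _ bb])
    fix x y z assume xyz: "x \<in> space (Leb n)" "y \<in> space (Leb n)" "z \<in> space (Leb n)"
      and z: "\<And>i. i < n \<Longrightarrow> z i = s * x i + t * y i"
    show "1 * indicator A x powr l * indicator B y powr (1 - l) \<le> (indicator ?C z :: real)"
    proof (cases "x \<in> A \<and> y \<in> B")
      case True
      have "sqd n (\<lambda>_. (s + t) * m) z
        = (\<Sum>i<n. s * (s + t) * (x i - m)\<^sup>2 + t * (s + t) * (y i - m)\<^sup>2 - s * t * (y i - x i)\<^sup>2)"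
        unfolding sqd_def by (intro sum.cong) (auto simp: z power2_eq_square algebra_simps)
      also have "\<dots> = s * (s + t) * sqd n (\<lambda>_. m) x + t * (s + t) * sqd n (\<lambda>_. m) y - s * t * sqd n x y"
        by (simp add: sqd_def sum.distrib sum_subtractf sum_distrib_left)
      also have "\<dots> \<le> s * (s + t) * (real n * \<sigma>X\<^sup>2 * (1 + e)) + t * (s + t) * (real n * \<sigma>Y\<^sup>2 * (1 + e))
          - s * t * (real n * D)"
        using True st by (intro diff_mono add_mono mult_left_mono shA shB far) auto
      also have "\<dots> = real n * ((1 + e) * (s * (s + t) * \<sigma>X\<^sup>2 + t * (s + t) * \<sigma>Y\<^sup>2) - s * t * D)"
        by (simp add: algebra_simps)
      also have "\<dots> \<le> real n * q\<^sup>2" using qge by (intro mult_left_mono) auto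
      finally show ?thesis using True xyz by simp
    qed (use l in auto)
  qed simp
  moreover have "measure (Leb n) ?C \<le> (exp (1 / 2) * (sqrt (2 * pi) * q)) ^ n"
    using volume_ball_le[OF q, of n "\<lambda>_. (s + t) * m"] q unfolding measure_def
    by (intro enn2real_leI) auto
  moreover have "\<And>S. S \<in> sets (Leb n) \<Longrightarrow> integral\<^sup>L (Leb n) (indicator S) = measure (Leb n) S"
    by (simp add: sets.Int_space_eq2)
  ultimately show ?thesis using A B C by simp
qed

lemma finite_measure_of_shell:
  assumes A: "A \<in> sets (Leb n)" and "\<And>x. x \<in> A \<Longrightarrow> sqd n (\<lambda>_. m) x \<le> c"
  shows "emeasure (Leb n) A \<noteq> \<infinity>"
proof -
  have "integrable (Leb n) (indicator A :: _ \<Rightarrow> real)"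
    using box_bounded_integrable[OF box_bounded_indicator[OF assms]] .
  then show ?thesis using A by (auto simp: integrable_indicator_iff)
qed

text \<open>The choice \<open>s = l / (a \<sigma>X)\<close>, \<open>t = (1 - l) / \<sigma>Y\<close> rescales a part of the \<open>X\<close>-sphere of probability
  \<open>a ^ n\<close> and the whole \<open>Y\<close>-sphere to equal volume.\<close>

lemma separated_sets_prob:
  assumes sig: "\<sigma>X > 0" "\<sigma>Y > 0" and a: "a > 0" and l: "0 < l" "l < 1" and q: "q > 0"
    and A: "A \<in> sets (Leb n)" and B: "B \<in> sets (Leb n)"
    and shA: "\<And>x. x \<in> A \<Longrightarrow> \<bar>sqd n (\<lambda>_. m) x - real n * \<sigma>X\<^sup>2\<bar> \<le> real n * \<sigma>X\<^sup>2 * e"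
    and shB: "\<And>y. y \<in> B \<Longrightarrow> \<bar>sqd n (\<lambda>_. m) y - real n * \<sigma>Y\<^sup>2\<bar> \<le> real n * \<sigma>Y\<^sup>2 * e"
    and far: "\<And>x y. x \<in> A \<Longrightarrow> y \<in> B \<Longrightarrow> real n * D \<le> sqd n x y"
    and s: "s = l / (a * \<sigma>X)" and t: "t = (1 - l) / \<sigma>Y"
    and qge: "(1 + e) * (s * (s + t) * \<sigma>X\<^sup>2 + t * (s + t) * \<sigma>Y\<^sup>2) - s * t * D \<le> q\<^sup>2"
    and pA: "a ^ n / 4 \<le> measure (gprod n (\<lambda>_. m) \<sigma>X) A" and pB: "1 / 4 \<le> measure (gprod n (\<lambda>_. m) \<sigma>Y) B"
  shows "1 / 4 \<le> (q * exp (e / 2)) ^ n"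
proof -
  let ?w = "exp ((1 - e) / 2) * sqrt (2 * pi)"
  have st: "s > 0" "t > 0" using s t l a sig by auto
  have shA': "sqd n (\<lambda>_. m) x \<le> real n * \<sigma>X\<^sup>2 * (1 + e)" "real n * \<sigma>X\<^sup>2 * (1 - e) \<le> sqd n (\<lambda>_. m) x"
    if "x \<in> A" for x using shA[OF that] by (auto simp: algebra_simps)
  have shB': "sqd n (\<lambda>_. m) x \<le> real n * \<sigma>Y\<^sup>2 * (1 + e)" "real n * \<sigma>Y\<^sup>2 * (1 - e) \<le> sqd n (\<lambda>_. m) x"
    if "x \<in> B" for x using shB[OF that] by (auto simp: algebra_simps)
  have vA: "1 / 4 * (a * (?w * \<sigma>X)) ^ n \<le> measure (Leb n) A"
  proof -
    have "1 / 4 * (a * (?w * \<sigma>X)) ^ n = (a ^ n / 4) * (?w * \<sigma>X) ^ n" by (simp add: power_mult_distrib)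
    also have "\<dots> \<le> measure (gprod n (\<lambda>_. m) \<sigma>X) A * (?w * \<sigma>X) ^ n"
      using pA sig by (intro mult_right_mono) auto
    also have "\<dots> \<le> measure (Leb n) A"
      using measure_gprod_le_volume[OF sig(1) A finite_measure_of_shell[OF A shA'(1)] shA'(2)]
      by (simp add: mult_ac)
    finally show ?thesis .
  qed
  have vB: "1 / 4 * (?w * \<sigma>Y) ^ n \<le> measure (Leb n) B"
  proof -
    have "1 / 4 * (?w * \<sigma>Y) ^ n \<le> measure (gprod n (\<lambda>_. m) \<sigma>Y) B * (?w * \<sigma>Y) ^ n"
      using pB sig by (intro mult_right_mono) auto
    also have "\<dots> \<le> measure (Leb n) B"
      using measure_gprod_le_volume[OF sig(2) B finite_measure_of_shell[OF B shB'(1)] shB'(2)]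
      by (simp add: mult_ac)
    finally show ?thesis .
  qed
  \<comment> \<open>Since \<open>s / l\<close> is \<open>1 / (a * \<sigma>X)\<close> and
    \<open>t / (1 - l)\<close> is \<open>1 / \<sigma>Y\<close>, both sets rescale to the same base
    \<open>?w\<close>, which the geometric mean keeps.\<close>
  have K: "pl_const l s t * (a * (?w * \<sigma>X)) powr l * (?w * \<sigma>Y) powr (1 - l) = ?w"
  proof -
    have "pl_const l s t * (a * (?w * \<sigma>X)) powr l * (?w * \<sigma>Y) powr (1 - l)
      = ((s / l) powr l * (a * (?w * \<sigma>X)) powr l) * ((t / (1 - l)) powr (1 - l) * (?w * \<sigma>Y) powr (1 - l))"
      by (simp add: pl_const_def mult_ac)
    also have "\<dots> = (s / l * (a * (?w * \<sigma>X))) powr l * (t / (1 - l) * (?w * \<sigma>Y)) powr (1 - l)"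
    proof -
      have "x powr r * y powr r = (x * y) powr r" if "x > 0" "y > 0" for x y r :: real
        using that by (simp add: powr_mult)
      from this[of "s / l" "a * (?w * \<sigma>X)" l] this[of "t / (1 - l)" "?w * \<sigma>Y" "1 - l"]
      show ?thesis using st l a sig by simp
    qed
    also have "s / l * (a * (?w * \<sigma>X)) = ?w" using s l a sig by simp
    also have "t / (1 - l) * (?w * \<sigma>Y) = ?w" using t l sig by simp
    also have "?w powr l * ?w powr (1 - l) = ?w" by (simp add: powr_add[symmetric])
    finally show ?thesis .
  qed
  have pw: "(1 / 4 * z ^ n) powr r = (1 / 4) powr r * (z powr r) ^ n" if "z > 0" for z r :: real
  proof -
    have "(1 / 4 * z ^ n) powr r = (1 / 4) powr r * (z ^ n) powr r"
      by (rule powr_mult)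
    also have "(z ^ n) powr r = (z powr r) ^ n"
      using that by (simp add: powr_powr powr_realpow[symmetric] mult.commute)
    finally show ?thesis .
  qed
  \<comment> \<open>The weights \<open>l\<close> and \<open>1 - l\<close> add up to 1, so the two
    losses of \<open>1 / 4\<close> combine into a single one.\<close>
  have "1 / 4 * ?w ^ n = pl_const l s t ^ n * (1 / 4 * (a * (?w * \<sigma>X)) ^ n) powr l * (1 / 4 * (?w * \<sigma>Y) ^ n) powr (1 - l)"
  proof -
    have "pl_const l s t ^ n * (1 / 4 * (a * (?w * \<sigma>X)) ^ n) powr l * (1 / 4 * (?w * \<sigma>Y) ^ n) powr (1 - l)
      = ((1 / 4) powr l * (1 / 4) powr (1 - l)) * (pl_const l s t * (a * (?w * \<sigma>X)) powr l * (?w * \<sigma>Y) powr (1 - l)) ^ n"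
      using a sig by (subst (1 2) pw) (auto simp: power_mult_distrib mult_ac)
    also have "\<dots> = 1 / 4 * ?w ^ n" unfolding K by (simp add: powr_add[symmetric])
    finally show ?thesis by simp
  qed
  also have "\<dots> \<le> pl_const l s t ^ n * measure (Leb n) A powr l * measure (Leb n) B powr (1 - l)"
    using vA vB l a sig by (intro mult_mono powr_mono2) (auto simp: pl_const_def)
  also have "\<dots> \<le> (exp (1 / 2) * (sqrt (2 * pi) * q)) ^ n"
    by (rule separated_sets_volume[OF sig st l q A B shA'(1) shB'(1) far qge])
  \<comment> \<open>The ball carries \<open>exp (1 / 2)\<close> and \<open>?w\<close> only
    \<open>exp ((1 - e) / 2)\<close>; the mismatch is the factor \<open>exp (e / 2)\<close>.\<close>
  also have "\<dots> = (q * exp (e / 2)) ^ n * ?w ^ n"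
    by (simp add: power_mult_distrib[symmetric] mult_ac exp_add[symmetric] add_divide_distrib[symmetric])
  finally show ?thesis by simp
qed

text \<open>At \<open>e = 0\<close> the left side of the last condition is
  \<open>(l / a)^2 + (1 - l)^2 + 2 \<rho> (l / a) (1 - l)\<close>, that is \<open>1 - 2 l w\<close>
  plus a term of order \<open>l^2\<close>, with \<open>w = 1 - \<rho> / a\<close> positive. A small
  \<open>l\<close> brings it below 1, and then continuity leaves room for a positive
  \<open>e\<close>.\<close>

lemma converse_parameters:
  fixes \<sigma>X \<sigma>Y D a :: real
  assumes sig: "\<sigma>X > 0" "\<sigma>Y > 0" and a: "a > 0" and lt: "(\<sigma>X\<^sup>2 + \<sigma>Y\<^sup>2 - D) / (2 * \<sigma>X * \<sigma>Y) < a"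
  obtains l e q s t where "0 < l" "l < 1" "e > 0" "q > 0" "q * exp (e / 2) < 1"
    "s = l / (a * \<sigma>X)" "t = (1 - l) / \<sigma>Y"
    "(1 + e) * (s * (s + t) * \<sigma>X\<^sup>2 + t * (s + t) * \<sigma>Y\<^sup>2) - s * t * D \<le> q\<^sup>2"
proof -
  define \<rho> where "\<rho> = (\<sigma>X\<^sup>2 + \<sigma>Y\<^sup>2 - D) / (2 * \<sigma>X * \<sigma>Y)"
  define w where "w = 1 - \<rho> / a"
  \<comment> \<open>Exceeds the coefficient of \<open>l^2\<close>; the added 1 makes it
    positive.\<close>
  define v where "v = \<bar>1 / a\<^sup>2 + 1 - 2 * \<rho> / a\<bar> + 1"
  have "\<rho> < a" using lt by (simp add: \<rho>_def)
  then have w: "w > 0" using a by (simp add: w_def)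
  have v: "v > 0" by (simp add: v_def)
  \<comment> \<open>The bound \<open>w / v\<close> lets the quadratic term use up at most half of
    the gain \<open>2 * l * w\<close>.\<close>
  define l where "l = min (1 / 2) (w / v)"
  have l: "0 < l" "l < 1" and lv: "l * v \<le> w"
    using w v by (auto simp: l_def min_def field_simps)
  define s t where "s = l / (a * \<sigma>X)" and "t = (1 - l) / \<sigma>Y"
  have st: "s > 0" "t > 0" using l a sig by (auto simp: s_def t_def)
  define C where "C = s * (s + t) * \<sigma>X\<^sup>2 + t * (s + t) * \<sigma>Y\<^sup>2"
  have C: "C > 0" using st sig by (auto simp: C_def intro!: add_pos_pos mult_pos_pos)
  \<comment> \<open>For large \<open>D\<close> the difference \<open>C - s * t * D\<close> can be
    negative; the maximum with \<open>1 / 2\<close> keeps the radius \<open>q\<close> real and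
    positive.\<close>
  define Q where "Q = max (1 / 2) (C - s * t * D)"
  have "C - s * t * D = (s * \<sigma>X)\<^sup>2 + (t * \<sigma>Y)\<^sup>2 + s * t * (\<sigma>X\<^sup>2 + \<sigma>Y\<^sup>2 - D)"
    by (simp add: C_def power2_eq_square algebra_simps)
  also have "\<sigma>X\<^sup>2 + \<sigma>Y\<^sup>2 - D = 2 * \<rho> * \<sigma>X * \<sigma>Y" using sig by (simp add: \<rho>_def)
  also have "(s * \<sigma>X)\<^sup>2 + (t * \<sigma>Y)\<^sup>2 + s * t * (2 * \<rho> * \<sigma>X * \<sigma>Y)
      = (l / a)\<^sup>2 + (1 - l)\<^sup>2 + 2 * \<rho> * (l / a) * (1 - l)"
    using sig by (simp add: s_def t_def)
  also have "\<dots> = 1 - 2 * l * w + l * (l * (1 / a\<^sup>2 + 1 - 2 * \<rho> / a))"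
    using a by (simp add: w_def power2_eq_square field_simps)
  also have "l * (1 / a\<^sup>2 + 1 - 2 * \<rho> / a) \<le> l * v" using l by (intro mult_left_mono) (auto simp: v_def)
  also have "l * v \<le> w" by (rule lv)
  finally have "C - s * t * D \<le> 1 - l * w" using l by (simp add: algebra_simps)
  moreover have "l * w > 0" using l w by simp
  ultimately have Q: "1 / 2 \<le> Q" "C - s * t * D \<le> Q" "Q < 1" by (auto simp: Q_def)
  have "((\<lambda>e. sqrt (Q + e * C) * exp (e / 2)) \<longlongrightarrow> sqrt (Q + 0 * C) * exp (0 / 2)) (at_right 0)"
    by (intro tendsto_intros) auto
  moreover have "sqrt (Q + 0 * C) * exp (0 / 2) < 1" using Q by simp
  ultimately have "\<forall>\<^sub>F e in at_right 0. sqrt (Q + e * C) * exp (e / 2) < 1"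
    by (rule order_tendstoD(2))
  then have "\<forall>\<^sub>F e in at_right 0. sqrt (Q + e * C) * exp (e / 2) < 1 \<and> 0 < e"
    using eventually_at_right_less[of "0::real"] by (rule eventually_conj)
  then obtain e where e: "sqrt (Q + e * C) * exp (e / 2) < 1" "0 < e"
    using eventually_happens' trivial_limit_at_right_real by blast
  have QC: "Q + e * C > 0" using Q e C by (intro add_pos_pos) auto
  show ?thesis
  proof (rule that[OF l e(2) _ e(1) s_def t_def])
    show "sqrt (Q + e * C) > 0" using QC by simp
    have "(1 + e) * C - s * t * D \<le> Q + e * C" using Q by (simp add: algebra_simps)
    then show "(1 + e) * (s * (s + t) * \<sigma>X\<^sup>2 + t * (s + t) * \<sigma>Y\<^sup>2) - s * t * D \<le> (sqrt (Q + e * C))\<^sup>2"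
      using QC by (simp add: C_def[symmetric])
  qed
qed

section \<open>Counting signatures and the pigeonhole argument\<close>

lemma finite_signatures: "finite (signatures R n)"
  and card_signatures_le: "real (card (signatures R n)) \<le> 2 powr (real n * R)"
proof -
  have sub: "signatures R n \<subseteq> {1..nat \<lfloor>2 powr (real n * R)\<rfloor>}"
    by (auto simp: signatures_def le_nat_floor)
  then show "finite (signatures R n)" by (rule finite_subset) simp
  have "card (signatures R n) \<le> nat \<lfloor>2 powr (real n * R)\<rfloor>"
    using card_mono[OF _ sub] by simp
  then show "real (card (signatures R n)) \<le> 2 powr (real n * R)"
    by (simp add: le_nat_floor of_nat_floor order_trans[OF of_nat_mono])
qed

lemma sets_Rn: "sets (Rn n) = sets (Leb n)"
  unfolding Rn_def by (intro sets_PiM_cong) auto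

lemma space_Rn: "space (Rn n) = space (Leb n)"
  by (simp add: Rn_def space_PiM)

lemma measurable_sections:
  assumes "id_system R n T g"
  shows "\<And>i. {x \<in> space (Leb n). T x = i} \<in> sets (Leb n)"
    and "\<And>i. i \<in> signatures R n \<Longrightarrow> {y \<in> space (Leb n). g (i, y) = a} \<in> sets (Leb n)"
    and "\<And>x. x \<in> space (Leb n) \<Longrightarrow> T x \<in> signatures R n"
proof -
  have T: "T \<in> Leb n \<rightarrow>\<^sub>M count_space (signatures R n)"
    and g: "g \<in> count_space (signatures R n) \<Otimes>\<^sub>M Leb n \<rightarrow>\<^sub>M count_space UNIV"
    using assms unfolding id_system_def
    by (auto simp: measurable_cong_sets[OF sets_Rn refl]
        measurable_cong_sets[OF sets_pair_measure_cong[OF refl sets_Rn] refl])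
  show sp: "T x \<in> signatures R n" if "x \<in> space (Leb n)" for x
    using measurable_space[OF T that] by simp
  show "{x \<in> space (Leb n). T x = i} \<in> sets (Leb n)" for i
  proof (cases "i \<in> signatures R n")
    case True
    then have "T -` {i} \<inter> space (Leb n) \<in> sets (Leb n)" by (intro measurable_sets[OF T]) simp
    also have "T -` {i} \<inter> space (Leb n) = {x \<in> space (Leb n). T x = i}" by auto
    finally show ?thesis .
  next
    case False
    then have "{x \<in> space (Leb n). T x = i} = {}" using sp by auto
    then show ?thesis by (metis sets.empty_sets)
  qed
  show "{y \<in> space (Leb n). g (i, y) = a} \<in> sets (Leb n)" if i: "i \<in> signatures R n" for i
  proof -
    have "(\<lambda>y. g (i, y)) \<in> Leb n \<rightarrow>\<^sub>M count_space UNIV"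
      using i by (intro measurable_compose[OF _ g] measurable_Pair1') simp
    from measurable_sets[OF this, of "{a}"]
    have "(\<lambda>y. g (i, y)) -` {a} \<inter> space (Leb n) \<in> sets (Leb n)" by simp
    also have "(\<lambda>y. g (i, y)) -` {a} \<inter> space (Leb n) = {y \<in> space (Leb n). g (i, y) = a}" by auto
    finally show ?thesis .
  qed
qed

text \<open>The event is a disjoint union of rectangles, one for each signature, and the product
  measure factors on each of them.\<close>

lemma prob_maybe_eq_sum:
  assumes sys: "id_system R n T g" and sig: "\<sigma>X > 0" "\<sigma>Y > 0"
  shows "prob_maybe (gaussian \<mu> \<sigma>X) (gaussian \<mu> \<sigma>Y) n T g =
    (\<Sum>i\<in>signatures R n. measure (gprod n (\<lambda>_. \<mu>) \<sigma>X) {x \<in> space (Leb n). T x = i}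
      * measure (gprod n (\<lambda>_. \<mu>) \<sigma>Y) {y \<in> space (Leb n). g (i, y) = Maybe})"
proof -
  let ?P = "gprod n (\<lambda>_. \<mu>) \<sigma>X" and ?Q = "gprod n (\<lambda>_. \<mu>) \<sigma>Y"
  interpret P: prob_space ?P by (rule prob_space_gprod[OF sig(1)])
  interpret Q: prob_space ?Q by (rule prob_space_gprod[OF sig(2)])
  interpret PQ: pair_prob_space ?P ?Q ..
  let ?A = "\<lambda>i. {x \<in> space (Leb n). T x = i}" and ?B = "\<lambda>i. {y \<in> space (Leb n). g (i, y) = Maybe}"
  have AB: "?A i \<in> sets ?P" "?B i \<in> sets ?Q" if "i \<in> signatures R n" for i
    using measurable_sections[OF sys] that by (auto simp: sets_gprod)
  have "{(x, y) \<in> space (?P \<Otimes>\<^sub>M ?Q). g (T x, y) = Maybe} = (\<Union>i\<in>signatures R n. ?A i \<times> ?B i)"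
    using measurable_sections(3)[OF sys] by (auto simp: space_pair_measure space_gprod)
  then have "prob_maybe (gaussian \<mu> \<sigma>X) (gaussian \<mu> \<sigma>Y) n T g
      = measure (?P \<Otimes>\<^sub>M ?Q) (\<Union>i\<in>signatures R n. ?A i \<times> ?B i)"
    by (simp add: prob_maybe_def source_law_def)
  also have "\<dots> = (\<Sum>i\<in>signatures R n. measure (?P \<Otimes>\<^sub>M ?Q) (?A i \<times> ?B i))"
    by (intro PQ.finite_measure_finite_Union finite_signatures)
      (auto intro!: pair_measureI AB simp: disjoint_family_on_def)
  also have "\<dots> = (\<Sum>i\<in>signatures R n. measure ?P (?A i) * measure ?Q (?B i))"
    using AB by (intro sum.cong refl) (simp add: measure_def Q.emeasure_pair_measure_Times enn2real_mult)
  finally show ?thesis .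
qed

text \<open>There are at most \<open>a ^ (- n)\<close> signatures, so some cell keeps probability
  \<open>a ^ n / 4\<close> while \<open>No\<close> is answered with probability at least
  \<open>1 / 4\<close>, both after restriction to typical norms. Admissibility separates these two
  sets, and \<open>separated_sets_prob\<close> then contradicts \<open>q * exp (e / 2) < 1\<close>
  for large \<open>n\<close>.\<close>

lemma achievable_rate_lower_bound:
  fixes \<mu> \<sigma>X \<sigma>Y D R :: real
  assumes sig: "\<sigma>X > 0" "\<sigma>Y > 0" and ach: "achievable D (gaussian \<mu> \<sigma>X) (gaussian \<mu> \<sigma>Y) R"
  shows "2 powr (- R) \<le> (\<sigma>X\<^sup>2 + \<sigma>Y\<^sup>2 - D) / (2 * \<sigma>X * \<sigma>Y)"
proof (rule ccontr)
  define a where "a = 2 powr (- R)"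
  have a: "a > 0" by (simp add: a_def)
  assume "\<not> 2 powr (- R) \<le> (\<sigma>X\<^sup>2 + \<sigma>Y\<^sup>2 - D) / (2 * \<sigma>X * \<sigma>Y)"
  then have lt: "(\<sigma>X\<^sup>2 + \<sigma>Y\<^sup>2 - D) / (2 * \<sigma>X * \<sigma>Y) < a" by (simp add: a_def)
  obtain l e q s t where par: "0 < l" "l < 1" "e > 0" "q > 0" "q * exp (e / 2) < 1"
    "s = l / (a * \<sigma>X)" "t = (1 - l) / \<sigma>Y"
    "(1 + e) * (s * (s + t) * \<sigma>X\<^sup>2 + t * (s + t) * \<sigma>Y\<^sup>2) - s * t * D \<le> q\<^sup>2"
    by (rule converse_parameters[OF sig a lt])
  obtain T g where sys: "\<And>n. n \<ge> 1 \<Longrightarrow> id_system R n (T n) (g n)"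
    and adm: "\<And>n. n \<ge> 1 \<Longrightarrow> admissible D n (T n) (g n)"
    and lim: "(\<lambda>n. prob_maybe (gaussian \<mu> \<sigma>X) (gaussian \<mu> \<sigma>Y) n (T n) (g n)) \<longlonglongrightarrow> 0"
    using ach unfolding achievable_def by blast
  \<comment> \<open>The thresholds leave slack in the final count: \<open>1 / 4\<close> from small
    cells, under \<open>2 * (1 / 8)\<close> from false alarms and \<open>1 / 4\<close> from atypical
    \<open>x\<close> stay below 1.\<close>
  have "\<forall>\<^sub>F n in sequentially. prob_maybe (gaussian \<mu> \<sigma>X) (gaussian \<mu> \<sigma>Y) n (T n) (g n) < 1 / 8"
    using lim by (rule order_tendstoD) simp
  moreover have "(\<lambda>n. (q * exp (e / 2)) ^ n) \<longlonglongrightarrow> 0" using par by (intro LIMSEQ_power_zero) auto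
  then have "\<forall>\<^sub>F n in sequentially. (q * exp (e / 2)) ^ n < 1 / 4"
    by (rule order_tendstoD) simp
  moreover have "(\<lambda>n. (2 / e\<^sup>2) * inverse (real n)) \<longlonglongrightarrow> (2 / e\<^sup>2) * 0"
    by (intro tendsto_intros lim_inverse_n)
  then have "\<forall>\<^sub>F n in sequentially. (2 / e\<^sup>2) * inverse (real n) < 1 / 4"
    by (rule order_tendstoD) simp
  moreover have "\<forall>\<^sub>F n in sequentially. 1 \<le> n" by (rule eventually_ge_at_top)
  ultimately have "\<forall>\<^sub>F n in sequentially. prob_maybe (gaussian \<mu> \<sigma>X) (gaussian \<mu> \<sigma>Y) n (T n) (g n) < 1 / 8
    \<and> (q * exp (e / 2)) ^ n < 1 / 4 \<and> (2 / e\<^sup>2) * inverse (real n) < 1 / 4 \<and> 1 \<le> n"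
    by eventually_elim simp
  then obtain n where pm: "prob_maybe (gaussian \<mu> \<sigma>X) (gaussian \<mu> \<sigma>Y) n (T n) (g n) < 1 / 8"
    and qn: "(q * exp (e / 2)) ^ n < 1 / 4" and en: "2 / (real n * e\<^sup>2) < 1 / 4" and n: "n \<ge> 1"
    by (auto simp: eventually_sequentially divide_simps mult_ac)
  let ?P = "gprod n (\<lambda>_. \<mu>) \<sigma>X" and ?Q = "gprod n (\<lambda>_. \<mu>) \<sigma>Y" and ?S = "signatures R n"
  interpret P: prob_space ?P by (rule prob_space_gprod[OF sig(1)])
  interpret Q: prob_space ?Q by (rule prob_space_gprod[OF sig(2)])
  note sec = measurable_sections[OF sys[OF n]]
  let ?far = "\<lambda>\<sigma>. {x \<in> space (Leb n). real n * \<sigma>\<^sup>2 * e \<le> \<bar>sqd n (\<lambda>_. \<mu>) x - real n * \<sigma>\<^sup>2\<bar>}"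
  have far_meas: "?far \<sigma> \<in> sets (Leb n)" for \<sigma> by measurable
  have far: "measure (gprod n (\<lambda>_. \<mu>) \<sigma>) (?far \<sigma>) \<le> 1 / 4" if "\<sigma> > 0" for \<sigma>
    using gprod_shell[OF that \<open>e > 0\<close>, of n "\<lambda>_. \<mu>"] n en by linarith
  define TT where "TT i = {x \<in> space (Leb n). T n x = i}" for i
  define MM where "MM i = {y \<in> space (Leb n). g n (i, y) = Maybe}" for i
  define A where "A i = TT i - ?far \<sigma>X" for i
  define B where "B i = {y \<in> space (Leb n). g n (i, y) = No} - ?far \<sigma>Y" for i
  have TTm: "TT i \<in> sets (Leb n)" for i unfolding TT_def by (rule sec(1))
  have MMm: "MM i \<in> sets (Leb n)" if "i \<in> ?S" for i unfolding MM_def by (rule sec(2)[OF that])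
  have Am: "A i \<in> sets (Leb n)" for i using TTm far_meas by (auto simp: A_def)
  have Bm: "B i \<in> sets (Leb n)" if "i \<in> ?S" for i
    using sec(2)[OF that, of No] far_meas by (auto simp: B_def)
  have "\<exists>i\<in>?S. a ^ n / 4 \<le> measure ?P (A i) \<and> 1 / 4 \<le> measure ?Q (B i)"
  proof (rule ccontr)
    assume no: "\<not> ?thesis"
    \<comment> \<open>If the cell is not small, the assumption makes \<open>B i\<close> improbable,
      so \<open>Maybe\<close> has probability at least \<open>1 / 2\<close> and the cell is paid for
      by twice its share of \<open>prob_maybe\<close>.\<close>
    have le: "measure ?P (A i) \<le> a ^ n / 4 + 2 * (measure ?P (TT i) * measure ?Q (MM i))" if i: "i \<in> ?S" for i
    proof (cases "a ^ n / 4 \<le> measure ?P (A i)")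
      case False
      then show ?thesis by (simp add: add_increasing2)
    next
      case True
      with no i have "measure ?Q (B i) < 1 / 4" by auto
      moreover have "1 \<le> measure ?Q (B i) + measure ?Q (?far \<sigma>Y) + measure ?Q (MM i)"
      proof -
        have "space ?Q = B i \<union> ?far \<sigma>Y \<union> MM i"
          using answer.exhaust by (auto simp: B_def MM_def space_gprod)
        then have "1 = measure ?Q (B i \<union> ?far \<sigma>Y \<union> MM i)" using Q.prob_space by metis
        also have "\<dots> \<le> measure ?Q (B i \<union> ?far \<sigma>Y) + measure ?Q (MM i)"
          using Bm MMm i far_meas by (intro measure_Un_le) (auto simp: sets_gprod)
        also have "measure ?Q (B i \<union> ?far \<sigma>Y) \<le> measure ?Q (B i) + measure ?Q (?far \<sigma>Y)"
          using Bm i far_meas by (intro measure_Un_le) (auto simp: sets_gprod)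
        finally show ?thesis by simp
      qed
      ultimately have "1 / 2 \<le> measure ?Q (MM i)" using far[OF sig(2)] by linarith
      then have "measure ?P (TT i) * (1 / 2) \<le> measure ?P (TT i) * measure ?Q (MM i)"
        by (rule mult_left_mono) simp
      moreover have "measure ?P (A i) \<le> measure ?P (TT i)"
        using TTm by (intro P.finite_measure_mono) (auto simp: A_def sets_gprod)
      moreover have "0 \<le> a ^ n / 4" using a by simp
      ultimately show ?thesis by linarith
    qed
    have "1 \<le> measure ?P (\<Union>i\<in>?S. A i) + measure ?P (?far \<sigma>X)"
    proof -
      have "space ?P = (\<Union>i\<in>?S. A i) \<union> ?far \<sigma>X"
        using sec(3) by (auto simp: A_def TT_def space_gprod)
      then have "1 = measure ?P ((\<Union>i\<in>?S. A i) \<union> ?far \<sigma>X)" using P.prob_space by metis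
      also have "\<dots> \<le> measure ?P (\<Union>i\<in>?S. A i) + measure ?P (?far \<sigma>X)"
        using Am far_meas finite_signatures by (intro measure_Un_le) (auto simp: sets_gprod)
      finally show ?thesis .
    qed
    also have "measure ?P (\<Union>i\<in>?S. A i) \<le> (\<Sum>i\<in>?S. measure ?P (A i))"
      using Am by (intro P.finite_measure_subadditive_finite finite_signatures) (auto simp: sets_gprod)
    also have "\<dots> \<le> (\<Sum>i\<in>?S. a ^ n / 4 + 2 * (measure ?P (TT i) * measure ?Q (MM i)))"
      by (intro sum_mono le)
    also have "\<dots> = real (card ?S) * (a ^ n / 4) + 2 * prob_maybe (gaussian \<mu> \<sigma>X) (gaussian \<mu> \<sigma>Y) n (T n) (g n)"
      unfolding prob_maybe_eq_sum[OF sys[OF n] sig] TT_def MM_def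
      by (simp add: sum.distrib sum_distrib_left)
    also have "real (card ?S) * (a ^ n / 4) \<le> 2 powr (real n * R) * (a ^ n / 4)"
      using a by (intro mult_right_mono card_signatures_le) auto
    also have "a ^ n = 2 powr (- (real n * R))"
      by (simp add: a_def powr_realpow[symmetric] powr_powr mult.commute)
    also have "2 powr (real n * R) * (2 powr (- (real n * R)) / 4) = 1 / 4"
      by (simp add: powr_minus)
    finally show False using pm far[OF sig(1)] by linarith
  qed
  then obtain i where i: "i \<in> ?S" and pA: "a ^ n / 4 \<le> measure ?P (A i)" and pB: "1 / 4 \<le> measure ?Q (B i)"
    by auto
  have "1 / 4 \<le> (q * exp (e / 2)) ^ n"
  proof (rule separated_sets_prob[OF sig a par(1,2,4) Am Bm[OF i] _ _ _ par(6,7,8) pA pB])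
    fix x y assume x: "x \<in> A i" and y: "y \<in> B i"
    have xy: "x \<in> space (Rn n)" "y \<in> space (Rn n)" "T n x = i" "g n (i, y) = No"
      using x y by (auto simp: A_def B_def TT_def space_Rn)
    then have "D < dist_avg n y x"
      using adm[OF n] by (fastforce simp: admissible_def dist_avg_def power2_commute)
    then show "real n * D \<le> sqd n x y" using n by (simp add: dist_avg_def sqd_def field_simps)
  qed (auto simp: A_def B_def TT_def)
  with qn show False by linarith
qed

section \<open>Achievability\<close>

text \<open>Signature 1 is reserved for uncovered \<open>x\<close> and always answered
  \<open>Maybe\<close>, hence \<open>N + 1\<close> signatures; the signature of cell
  \<open>i\<close> is answered \<open>No\<close> on \<open>V i\<close>. A false alarm comes from an
  uncovered \<open>x\<close> or from a \<open>y\<close> outside the set \<open>V\<close> of its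
  cell.\<close>

lemma exists_system_of_cells:
  fixes E V :: "nat \<Rightarrow> (nat \<Rightarrow> real) set"
  assumes sig: "\<sigma>X > 0" "\<sigma>Y > 0" and card: "real N + 1 \<le> 2 powr (real n * R)"
    and E: "\<And>i. E i \<in> sets (Leb n)" and V: "\<And>i. V i \<in> sets (Leb n)"
    and sep: "\<And>i x y. i < N \<Longrightarrow> x \<in> E i \<Longrightarrow> y \<in> V i \<Longrightarrow> D < dist_avg n x y"
  obtains T g where "id_system R n T g" "admissible D n T g"
    "\<And>\<eta>. 0 \<le> \<eta> \<Longrightarrow> (\<And>i. i < N \<Longrightarrow> measure (gprod n (\<lambda>_. \<mu>) \<sigma>Y) (space (Leb n) - V i) \<le> \<eta>) \<Longrightarrow>
      prob_maybe (gaussian \<mu> \<sigma>X) (gaussian \<mu> \<sigma>Y) n T g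
        \<le> measure (gprod n (\<lambda>_. \<mu>) \<sigma>X) (space (Leb n) - (\<Union>i<N. E i)) + \<eta>"
proof -
  let ?S = "signatures R n"
  \<comment> \<open>Overlapping cells are made disjoint by taking the first one. The offset is 2
    because signatures start at 1 and 1 is reserved.\<close>
  define T where "T x = (if \<exists>i<N. x \<in> E i then 2 + (LEAST i. i < N \<and> x \<in> E i) else 1)" for x
  define g where "g p = (if 2 \<le> fst p \<and> snd p \<in> V (fst p - 2) then No else Maybe)" for p :: "nat \<times> (nat \<Rightarrow> real)"
  have T2: "\<exists>i<N. T x = 2 + i \<and> x \<in> E i" if "\<exists>i<N. x \<in> E i" for x
    using LeastI_ex[OF that] that by (auto simp: T_def)
  have T1: "T x = 1" if "\<not> (\<exists>i<N. x \<in> E i)" for x using that by (simp add: T_def)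
  have TS: "T x \<in> ?S" for x
    using T2[of x] T1[of x] card by (cases "\<exists>i<N. x \<in> E i") (auto simp: signatures_def)
  note [measurable] = E V
  have "T \<in> Leb n \<rightarrow>\<^sub>M count_space UNIV" unfolding T_def by measurable
  then have "T \<in> Leb n \<rightarrow>\<^sub>M count_space ?S"
    using TS by (auto simp: measurable_def)
  moreover have "g \<in> count_space ?S \<Otimes>\<^sub>M Leb n \<rightarrow>\<^sub>M count_space UNIV"
  proof (rule measurable_pair_measure_countable1)
    show "countable ?S" using finite_signatures by (rule countable_finite)
    show "(\<lambda>y. g (i, y)) \<in> Leb n \<rightarrow>\<^sub>M count_space UNIV" for i
      unfolding g_def by (cases "2 \<le> i") simp_all
  qed
  ultimately have sys: "id_system R n T g"
    unfolding id_system_def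
    by (auto simp: measurable_cong_sets[OF sets_Rn refl]
        measurable_cong_sets[OF sets_pair_measure_cong[OF refl sets_Rn] refl])
  have adm: "admissible D n T g"
    unfolding admissible_def
  proof (intro ballI impI)
    fix x y assume d: "dist_avg n x y \<le> D"
    show "g (T x, y) = Maybe"
    proof (cases "\<exists>i<N. x \<in> E i")
      case True
      then show ?thesis using T2[OF True] sep[of _ x y] d by (force simp: g_def)
    qed (simp add: T1 g_def)
  qed
  show ?thesis
  proof (rule that[OF sys adm])
    fix \<eta> :: real
    assume \<eta>: "0 \<le> \<eta>" and VN: "\<And>i. i < N \<Longrightarrow> measure (gprod n (\<lambda>_. \<mu>) \<sigma>Y) (space (Leb n) - V i) \<le> \<eta>"
    let ?P = "gprod n (\<lambda>_. \<mu>) \<sigma>X" and ?Q = "gprod n (\<lambda>_. \<mu>) \<sigma>Y"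
    interpret P: prob_space ?P by (rule prob_space_gprod[OF sig(1)])
    interpret Q: prob_space ?Q by (rule prob_space_gprod[OF sig(2)])
    let ?T = "\<lambda>i. {x \<in> space (Leb n). T x = i}"
    have Tm: "?T i \<in> sets ?P" for i using measurable_sections(1)[OF sys] by (simp add: sets_gprod)
    have 1: "1 \<in> ?S" using card by (auto simp: signatures_def)
    have "prob_maybe (gaussian \<mu> \<sigma>X) (gaussian \<mu> \<sigma>Y) n T g
      = (\<Sum>i\<in>?S. measure ?P (?T i) * measure ?Q {y \<in> space (Leb n). g (i, y) = Maybe})"
      by (rule prob_maybe_eq_sum[OF sys sig])
    also have "\<dots> \<le> (\<Sum>i\<in>?S. (if i = 1 then measure ?P (?T 1) else 0) + \<eta> * measure ?P (?T i))"
    proof (rule sum_mono)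
      fix i assume i: "i \<in> ?S"
      consider "i = 1" | j where "i = 2 + j" "j < N" | j where "i = 2 + j" "N \<le> j"
      proof -
        have "i = 1 \<or> i = 2 + (i - 2)" using i by (auto simp: signatures_def)
        then show thesis using that by (cases "i - 2 < N") (auto simp: not_less)
      qed
      then show "measure ?P (?T i) * measure ?Q {y \<in> space (Leb n). g (i, y) = Maybe}
        \<le> (if i = 1 then measure ?P (?T 1) else 0) + \<eta> * measure ?P (?T i)"
      proof cases
        case 1
        have "measure ?P (?T i) * measure ?Q {y \<in> space (Leb n). g (i, y) = Maybe} \<le> measure ?P (?T i)"
          by (intro mult_left_le Q.prob_le_1) simp
        moreover have "0 \<le> \<eta> * measure ?P (?T i)" using \<eta> by simp
        ultimately show ?thesis using 1 by simp
      next
        case (2 j)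
        have "{y \<in> space (Leb n). g (i, y) = Maybe} = space (Leb n) - V j" using 2 by (auto simp: g_def)
        then have "measure ?P (?T i) * measure ?Q {y \<in> space (Leb n). g (i, y) = Maybe} \<le> measure ?P (?T i) * \<eta>"
          using VN[OF 2(2)] by (intro mult_left_mono) auto
        then show ?thesis using 2 by (simp add: mult.commute)
      next
        \<comment> \<open>Signatures beyond the last cell are never assigned.\<close>
        case (3 j)
        have "T x \<noteq> i" for x using T1[of x] T2[of x] 3 by (cases "\<exists>i<N. x \<in> E i") auto
        then show ?thesis using \<eta> by simp
      qed
    qed
    also have "\<dots> = measure ?P (?T 1) + \<eta> * (\<Sum>i\<in>?S. measure ?P (?T i))"
      using 1 finite_signatures[of R n] by (simp add: sum.distrib sum_distrib_left)
    also have "(\<Sum>i\<in>?S. measure ?P (?T i)) = measure ?P (\<Union>i\<in>?S. ?T i)"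
      using Tm by (intro P.finite_measure_finite_Union[symmetric] finite_signatures)
        (auto simp: disjoint_family_on_def)
    also have "\<eta> * measure ?P (\<Union>i\<in>?S. ?T i) \<le> \<eta>" using \<eta> by (intro mult_left_le P.prob_le_1)
    also have "?T 1 = space (Leb n) - (\<Union>i<N. E i)"
    proof -
      have "T x = 1 \<longleftrightarrow> \<not> (\<exists>i<N. x \<in> E i)" for x using T1[of x] T2[of x] by fastforce
      then show ?thesis by auto
    qed
    finally show "prob_maybe (gaussian \<mu> \<sigma>X) (gaussian \<mu> \<sigma>Y) n T g
        \<le> measure ?P (space (Leb n) - (\<Union>i<N. E i)) + \<eta>" by simp
  qed
qed

text \<open>Averaging over \<open>w\<close>: by Fubini the hit pairs have product measure at least
  \<open>c * prob S\<close>, while \<open>B\<close> has measure at most \<open>v\<close>. The lost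
  factor 2 lets the contradiction be read off from
  \<open>c * prob S \<le> c * prob S / 2\<close>.\<close>

lemma (in prob_space) exists_good_point:
  assumes N: "sigma_finite_measure N" and W [measurable]: "W \<in> sets (M \<Otimes>\<^sub>M N)"
    and S [measurable]: "S \<in> sets M" and B [measurable]: "B \<in> sets N" and ne: "B \<noteq> {}"
    and vB: "emeasure N B \<le> ennreal v" and v: "v > 0" and c: "c > 0"
    and hit: "\<And>x. x \<in> S \<Longrightarrow> ennreal c \<le> emeasure N {w \<in> B. (x, w) \<in> W}"
  shows "\<exists>w\<in>B. c / (2 * v) * prob S \<le> prob {x \<in> S. (x, w) \<in> W}"
proof (rule ccontr)
  assume "\<not> ?thesis"
  then have lt: "\<And>w. w \<in> B \<Longrightarrow> prob {x \<in> S. (x, w) \<in> W} < c / (2 * v) * prob S" by force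
  interpret N: sigma_finite_measure N by fact
  interpret pair_sigma_finite M N ..
  obtain w where "w \<in> B" using ne by blast
  \<comment> \<open>The strict inequality at a single \<open>w\<close> already excludes a null set
    \<open>S\<close>.\<close>
  have "0 \<le> prob {x \<in> S. (x, w) \<in> W}" by simp
  also note lt[OF \<open>w \<in> B\<close>]
  finally have pS: "prob S > 0" using v c by (simp add: zero_less_mult_iff zero_less_divide_iff)
  have "ennreal (c * prob S) = (\<integral>\<^sup>+x. ennreal c * indicator S x \<partial>M)"
    using c by (simp add: nn_integral_cmult emeasure_eq_measure ennreal_mult')
  also have "\<dots> \<le> (\<integral>\<^sup>+x. (\<integral>\<^sup>+w. indicator S x * indicator B w * indicator W (x, w) \<partial>N) \<partial>M)"
  proof (rule nn_integral_mono)
    fix x assume x: "x \<in> space M"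
    show "ennreal c * indicator S x \<le> (\<integral>\<^sup>+w. indicator S x * indicator B w * indicator W (x, w) \<partial>N)"
    proof (cases "x \<in> S")
      case True
      have m: "{w \<in> B. (x, w) \<in> W} \<in> sets N"
      proof -
        have "{w \<in> B. (x, w) \<in> W} = B \<inter> (Pair x -` W)" by auto
        then show ?thesis using sets_Pair1[OF W] B by auto
      qed
      have "(\<integral>\<^sup>+w. indicator S x * indicator B w * indicator W (x, w) \<partial>N)
        = (\<integral>\<^sup>+w. indicator {w \<in> B. (x, w) \<in> W} w \<partial>N)"
        using True by (intro nn_integral_cong) (auto simp: indicator_def)
      also have "\<dots> = emeasure N {w \<in> B. (x, w) \<in> W}" using m by simp
      finally show ?thesis using hit[OF True] True by simp
    qed simp
  qed
  also have "\<dots> = (\<integral>\<^sup>+w. (\<integral>\<^sup>+x. indicator S x * indicator B w * indicator W (x, w) \<partial>M) \<partial>N)"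
    by (rule Fubini'[symmetric]) measurable
  also have "\<dots> \<le> (\<integral>\<^sup>+w. ennreal (c / (2 * v) * prob S) * indicator B w \<partial>N)"
  proof (rule nn_integral_mono)
    fix w assume w: "w \<in> space N"
    show "(\<integral>\<^sup>+x. indicator S x * indicator B w * indicator W (x, w) \<partial>M) \<le> ennreal (c / (2 * v) * prob S) * indicator B w"
    proof (cases "w \<in> B")
      case True
      have m: "{x \<in> S. (x, w) \<in> W} \<in> sets M"
      proof -
        have "{x \<in> S. (x, w) \<in> W} = S \<inter> ((\<lambda>x. (x, w)) -` W)" by auto
        then show ?thesis using sets_Pair2[OF W] S by auto
      qed
      have "(\<integral>\<^sup>+x. indicator S x * indicator B w * indicator W (x, w) \<partial>M)
        = (\<integral>\<^sup>+x. indicator {x \<in> S. (x, w) \<in> W} x \<partial>M)"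
        using True by (intro nn_integral_cong) (auto simp: indicator_def)
      also have "\<dots> = emeasure M {x \<in> S. (x, w) \<in> W}" using m by simp
      also have "\<dots> \<le> ennreal (c / (2 * v) * prob S)"
        unfolding emeasure_eq_measure using lt[OF True] by (intro ennreal_leI) simp
      finally show ?thesis using True by simp
    qed simp
  qed
  also have "\<dots> = ennreal (c / (2 * v) * prob S) * emeasure N B" by (simp add: nn_integral_cmult)
  also have "\<dots> \<le> ennreal (c / (2 * v) * prob S) * ennreal v" by (intro mult_left_mono vB) simp
  also have "\<dots> = ennreal (c * prob S / 2)" using v c by (simp add: ennreal_mult'[symmetric])
  finally have "c * prob S \<le> c * prob S / 2" using c by (simp add: ennreal_le_iff)
  moreover have "0 < c * prob S" using c pS by simp
  ultimately show False by linarith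
qed

text \<open>Each new centre takes at least the fraction \<open>p\<close> of the mass still
  uncovered, so the remainder shrinks geometrically. The premise \<open>step\<close> ranges over all
  measurable subsets of \<open>S\<close> because the remainder depends on the earlier
  choices.\<close>

lemma (in prob_space) greedy_covering:
  assumes S: "S \<in> events" and E: "\<And>w. w \<in> B \<Longrightarrow> E w \<in> events" and p: "p \<le> 1"
    and step: "\<And>S'. S' \<in> events \<Longrightarrow> S' \<subseteq> S \<Longrightarrow> \<exists>w\<in>B. p * prob S' \<le> prob (S' \<inter> E w)"
  shows "\<exists>ws. (\<forall>i<N::nat. ws i \<in> B) \<and> prob (S - (\<Union>i<N. E (ws i))) \<le> (1 - p) ^ N"
proof (induction N)
  case 0
  then show ?case by simp
next
  case (Suc N)
  then obtain ws where ws: "\<And>i. i < N \<Longrightarrow> ws i \<in> B"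
    and le: "prob (S - (\<Union>i<N. E (ws i))) \<le> (1 - p) ^ N" by auto
  define S' where "S' = S - (\<Union>i<N. E (ws i))"
  have S': "S' \<in> events" "S' \<subseteq> S" unfolding S'_def using S E ws by auto
  from step[OF S'] obtain w where w: "w \<in> B" "p * prob S' \<le> prob (S' \<inter> E w)" by auto
  have "prob (S' - E w) = prob S' - prob (S' \<inter> E w)"
    using S' E[OF w(1)] by (simp add: finite_measure_Diff' Int_commute)
  also have "\<dots> \<le> (1 - p) * prob S'" using w by (simp add: algebra_simps)
  also have "\<dots> \<le> (1 - p) * (1 - p) ^ N" using le p by (intro mult_left_mono) (auto simp: S'_def)
  also have "S' - E w = S - (\<Union>i<Suc N. E ((ws(N := w)) i))"
    by (auto simp: S'_def lessThan_Suc)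
  finally show ?case using ws w by (intro exI[of _ "ws(N := w)"]) (auto simp: less_Suc_eq)
qed

section \<open>Covering the typical source vectors by cells around codewords\<close>

definition codeball :: "nat \<Rightarrow> real \<Rightarrow> real \<Rightarrow> real \<Rightarrow> (nat \<Rightarrow> real) set" where
  "codeball n \<mu> \<sigma> r = {w \<in> space (Leb n). sqd n (\<lambda>_. \<mu>) w \<le> real n * (\<sigma>\<^sup>2 * r)}"

text \<open>A ball around \<open>w\<close> from which short vectors are removed; the lower bound on
  the norm is what \<open>cell_separation\<close> uses to keep \<open>x\<close> away from
  \<open>y\<close>.\<close>

definition cell :: "nat \<Rightarrow> real \<Rightarrow> real \<Rightarrow> real \<Rightarrow> real \<Rightarrow> (nat \<Rightarrow> real) \<Rightarrow> (nat \<Rightarrow> real) set" where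
  "cell n \<mu> \<sigma> e r w = {x \<in> space (Leb n). real n * \<sigma>\<^sup>2 * (1 - e) \<le> sqd n (\<lambda>_. \<mu>) x \<and> sqd n w x \<le> real n * (\<sigma>\<^sup>2 * r)}"

lemma codeball_sets [measurable]: "codeball n \<mu> \<sigma> r \<in> sets (Leb n)"
  unfolding codeball_def by measurable

lemma cell_sets [measurable]: "cell n \<mu> \<sigma> e r w \<in> sets (Leb n)"
  unfolding cell_def by measurable

lemma sqd_commute: "sqd n x y = sqd n y x"
  by (simp add: sqd_def power2_commute)

text \<open>The points \<open>w\<close> are drawn around \<open>\<mu> + \<beta>\<^sup>2 (x - \<mu>)\<close>, as in the backward test channel of Gaussian
  rate distortion theory.\<close>

lemma volume_of_good_codewords:
  fixes \<mu> \<sigma> b \<beta> e :: real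
  assumes s: "\<sigma> > 0" and b: "0 < b" and be: "0 < \<beta>" and bb: "b\<^sup>2 + \<beta>\<^sup>2 = 1"
    and e: "0 < e" "e \<le> 1" and n: "n > 0" "2 / (real n * e\<^sup>2) \<le> 1 / 4"
    and x: "x \<in> space (Leb n)" and sh: "\<bar>sqd n (\<lambda>_. \<mu>) x - real n * \<sigma>\<^sup>2\<bar> \<le> real n * \<sigma>\<^sup>2 * e"
  shows "ennreal (1 / 2 * (exp ((1 - e) / 2) * (sqrt (2 * pi) * (\<beta> * b * \<sigma>))) ^ n)
    \<le> emeasure (Leb n) {w \<in> codeball n \<mu> \<sigma> (\<beta>\<^sup>2 * (1 + 3 * e)). x \<in> cell n \<mu> \<sigma> e (b\<^sup>2 * (1 + 3 * e)) w}"
proof -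
  define m where "m i = \<mu> + \<beta>\<^sup>2 * (x i - \<mu>)" for i
  \<comment> \<open>The conditional standard deviation of \<open>w\<close> given \<open>x\<close> in
    this channel.\<close>
  define t where "t = \<beta> * b * \<sigma>"
  have t: "t > 0" using s b be by (simp add: t_def)
  interpret G: prob_space "gprod n m t" by (rule prob_space_gprod[OF t])
  have b1: "b\<^sup>2 \<le> 1" "\<beta>\<^sup>2 \<le> 1" using bb zero_le_power2[of b] zero_le_power2[of \<beta>] by linarith+
  define X where "X = sqd n (\<lambda>_. \<mu>) x"
  have X: "real n * \<sigma>\<^sup>2 * (1 - e) \<le> X" "X \<le> real n * \<sigma>\<^sup>2 * (1 + e)"
    using sh by (auto simp: X_def algebra_simps)
  let ?L = "\<lambda>w. \<Sum>i<n. (x i - \<mu>) * (w i - m i)"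
  \<comment> \<open>Two atypical events for the noise \<open>w - m\<close>: its norm is off, or it
    is not nearly orthogonal to \<open>x - \<mu>\<close>. Each has probability at most
    \<open>1 / 4\<close>.\<close>
  let ?F1 = "{w \<in> space (Leb n). real n * t\<^sup>2 * e \<le> \<bar>sqd n m w - real n * t\<^sup>2\<bar>}"
  let ?F2 = "{w \<in> space (Leb n). real n * \<sigma>\<^sup>2 * e \<le> \<bar>?L w\<bar>}"
  let ?G = "space (Leb n) - ?F1 - ?F2"
  let ?H = "{w \<in> codeball n \<mu> \<sigma> (\<beta>\<^sup>2 * (1 + 3 * e)). x \<in> cell n \<mu> \<sigma> e (b\<^sup>2 * (1 + 3 * e)) w}"
  have Fm: "?F1 \<in> sets (Leb n)" "?F2 \<in> sets (Leb n)" by measurable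
  have "measure (gprod n m t) ?F1 \<le> 1 / 4"
    using gprod_shell[OF t e(1) n(1), of m] n(2) by linarith
  moreover have "measure (gprod n m t) ?F2 \<le> 1 / 4"
  proof -
    have "measure (gprod n m t) ?F2 \<le> t\<^sup>2 * X / (real n * \<sigma>\<^sup>2 * e)\<^sup>2"
      unfolding X_def sqd_def using n s e by (intro gprod_linear t) auto
    also have "\<dots> \<le> \<sigma>\<^sup>2 * (real n * \<sigma>\<^sup>2 * 2) / (real n * \<sigma>\<^sup>2 * e)\<^sup>2"
    proof (intro divide_right_mono mult_mono)
      have "\<beta>\<^sup>2 * b\<^sup>2 * \<sigma>\<^sup>2 \<le> 1 * 1 * \<sigma>\<^sup>2" using b1 by (intro mult_mono) auto
      then show "t\<^sup>2 \<le> \<sigma>\<^sup>2" by (simp add: t_def power_mult_distrib)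
      have "real n * \<sigma>\<^sup>2 * (1 + e) \<le> real n * \<sigma>\<^sup>2 * 2" using e by (intro mult_left_mono) auto
      then show "X \<le> real n * \<sigma>\<^sup>2 * 2" using X by linarith
    qed (auto simp: X_def sqd_nonneg)
    also have "\<dots> = 2 / (real n * e\<^sup>2)" using s e n by (simp add: field_simps power2_eq_square)
    finally show ?thesis using n by linarith
  qed
  moreover have "1 \<le> measure (gprod n m t) ?G + (measure (gprod n m t) ?F1 + measure (gprod n m t) ?F2)"
  proof -
    have "space (gprod n m t) = ?G \<union> (?F1 \<union> ?F2)" by (auto simp: space_gprod)
    then have "1 = measure (gprod n m t) (?G \<union> (?F1 \<union> ?F2))" using G.prob_space by metis
    also have "\<dots> \<le> measure (gprod n m t) ?G + measure (gprod n m t) (?F1 \<union> ?F2)"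
      using Fm by (intro measure_Un_le) (auto simp: sets_gprod)
    also have "measure (gprod n m t) (?F1 \<union> ?F2) \<le> measure (gprod n m t) ?F1 + measure (gprod n m t) ?F2"
      using Fm by (intro measure_Un_le) (auto simp: sets_gprod)
    finally show ?thesis by simp
  qed
  ultimately have G: "1 / 2 \<le> measure (gprod n m t) ?G" by linarith
  \<comment> \<open>Both squared norms are expanded around \<open>m\<close>. The factor
    \<open>1 + 3 * e\<close> collects \<open>1 + e\<close> from the norms of
    \<open>x - \<mu>\<close> and of the noise, joined by
    \<open>b\<^sup>2 + \<beta>\<^sup>2 = 1\<close>, and \<open>2 * e\<close> from the cross
    term.\<close>
  have sub: "?G \<subseteq> ?H"
  proof
    fix w assume w: "w \<in> ?G"
    then have ws: "w \<in> space (Leb n)" and Z: "sqd n m w \<le> real n * t\<^sup>2 * (1 + e)"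
      and L: "\<bar>?L w\<bar> \<le> real n * \<sigma>\<^sup>2 * e"
      by (auto simp: algebra_simps)
    have t2: "t\<^sup>2 = \<sigma>\<^sup>2 * \<beta>\<^sup>2 * b\<^sup>2" by (simp add: t_def power_mult_distrib)
    have "sqd n (\<lambda>_. \<mu>) w = (\<Sum>i<n. \<beta>\<^sup>2 * \<beta>\<^sup>2 * (x i - \<mu>)\<^sup>2 + 2 * \<beta>\<^sup>2 * ((x i - \<mu>) * (w i - m i)) + (w i - m i)\<^sup>2)"
      unfolding sqd_def m_def by (intro sum.cong) (auto simp: power2_eq_square algebra_simps)
    also have "\<dots> = \<beta>\<^sup>2 * \<beta>\<^sup>2 * X + 2 * \<beta>\<^sup>2 * ?L w + sqd n m w"
      by (simp add: X_def sqd_def sum.distrib sum_distrib_left)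
    also have "\<dots> \<le> \<beta>\<^sup>2 * \<beta>\<^sup>2 * (real n * \<sigma>\<^sup>2 * (1 + e)) + 2 * \<beta>\<^sup>2 * (real n * \<sigma>\<^sup>2 * e) + real n * t\<^sup>2 * (1 + e)"
      using X Z L by (intro add_mono mult_left_mono) auto
    also have "\<dots> = real n * (\<sigma>\<^sup>2 * \<beta>\<^sup>2) * ((b\<^sup>2 + \<beta>\<^sup>2) * (1 + e) + 2 * e)"
      unfolding t2 by (simp add: algebra_simps)
    also have "\<dots> = real n * (\<sigma>\<^sup>2 * (\<beta>\<^sup>2 * (1 + 3 * e)))"
      unfolding bb by (simp add: algebra_simps)
    finally have 1: "w \<in> codeball n \<mu> \<sigma> (\<beta>\<^sup>2 * (1 + 3 * e))" using ws by (simp add: codeball_def)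
    have be2: "\<beta>\<^sup>2 = 1 - b\<^sup>2" using bb by simp
    have "sqd n w x = (\<Sum>i<n. b\<^sup>2 * b\<^sup>2 * (x i - \<mu>)\<^sup>2 + 2 * b\<^sup>2 * (- ((x i - \<mu>) * (w i - m i))) + (w i - m i)\<^sup>2)"
      unfolding sqd_def m_def be2 by (intro sum.cong) (auto simp: power2_eq_square algebra_simps)
    also have "\<dots> = b\<^sup>2 * b\<^sup>2 * X + 2 * b\<^sup>2 * (- ?L w) + sqd n m w"
      by (simp add: X_def sqd_def sum.distrib sum_distrib_left sum_negf sum_subtractf)
    also have "\<dots> \<le> b\<^sup>2 * b\<^sup>2 * (real n * \<sigma>\<^sup>2 * (1 + e)) + 2 * b\<^sup>2 * (real n * \<sigma>\<^sup>2 * e) + real n * t\<^sup>2 * (1 + e)"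
      using X Z L by (intro add_mono mult_left_mono) auto
    also have "\<dots> = real n * (\<sigma>\<^sup>2 * b\<^sup>2) * ((b\<^sup>2 + \<beta>\<^sup>2) * (1 + e) + 2 * e)"
      unfolding t2 by (simp add: algebra_simps)
    also have "\<dots> = real n * (\<sigma>\<^sup>2 * (b\<^sup>2 * (1 + 3 * e)))"
      unfolding bb by (simp add: algebra_simps)
    finally have "x \<in> cell n \<mu> \<sigma> e (b\<^sup>2 * (1 + 3 * e)) w" using x X by (simp add: cell_def X_def)
    with 1 show "w \<in> ?H" by simp
  qed
  have Hm: "?H \<in> sets (Leb n)"
  proof -
    have "?H = {w \<in> space (Leb n). sqd n (\<lambda>_. \<mu>) w \<le> real n * (\<sigma>\<^sup>2 * (\<beta>\<^sup>2 * (1 + 3 * e)))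
        \<and> sqd n x w \<le> real n * (\<sigma>\<^sup>2 * (b\<^sup>2 * (1 + 3 * e)))}"
      using x X(1) sqd_commute[of n x] by (auto simp: cell_def codeball_def X_def)
    then show ?thesis by simp
  qed
  have finG: "emeasure (Leb n) ?G \<noteq> \<infinity>"
    by (rule finite_measure_of_shell[of _ _ \<mu>, where c="real n * (\<sigma>\<^sup>2 * (\<beta>\<^sup>2 * (1 + 3 * e)))"])
      (use sub Fm in \<open>auto simp: codeball_def\<close>)
  \<comment> \<open>On \<open>?G\<close> the noise is not too short, so the density is bounded above
    and probability \<open>1 / 2\<close> forces a large volume.\<close>
  have "1 / 2 * (exp ((1 - e) / 2) * (sqrt (2 * pi) * t)) ^ n
      \<le> measure (gprod n m t) ?G * (exp ((1 - e) / 2) * (sqrt (2 * pi) * t)) ^ n"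
    using G t by (intro mult_right_mono) auto
  also have "\<dots> \<le> measure (Leb n) ?G"
    using Fm finG by (intro measure_gprod_le_volume[OF t]) (auto simp: algebra_simps)
  finally have "ennreal (1 / 2 * (exp ((1 - e) / 2) * (sqrt (2 * pi) * t)) ^ n) \<le> emeasure (Leb n) ?G"
    using finG by (simp add: emeasure_eq_ennreal_measure ennreal_leI)
  also have "\<dots> \<le> emeasure (Leb n) ?H" by (intro emeasure_mono sub Hm)
  finally show ?thesis by (simp add: t_def)
qed

lemma volume_codeball_le:
  assumes "\<sigma> > 0" "r > 0"
  shows "emeasure (Leb n) (codeball n \<mu> \<sigma> r) \<le> ennreal ((exp (1 / 2) * (sqrt (2 * pi) * (\<sigma> * sqrt r))) ^ n)"
  using volume_ball_le[of "\<sigma> * sqrt r" n "\<lambda>_. \<mu>"] assms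
  by (simp add: codeball_def power_mult_distrib)

text \<open>By \<open>volume_of_good_codewords\<close> every typical \<open>x\<close> is served by a
  share of roughly \<open>b ^ n\<close> of the ball of centres, so \<open>exists_good_point\<close>
  always finds a centre whose cell takes the fraction \<open>p\<close> of what is left. Atypical
  \<open>x\<close> account for the last term.\<close>

lemma exists_covering:
  fixes \<mu> \<sigma> b \<beta> e :: real
  assumes s: "\<sigma> > 0" and b: "0 < b" and be: "0 < \<beta>" and bb: "b\<^sup>2 + \<beta>\<^sup>2 = 1"
    and e: "0 < e" "e \<le> 1" and n: "n > 0" "2 / (real n * e\<^sup>2) \<le> 1 / 4"
  defines "p \<equiv> (b * exp (- e / 2) / sqrt (1 + 3 * e)) ^ n / 4"
  obtains ws where "\<And>i. i < N \<Longrightarrow> ws i \<in> codeball n \<mu> \<sigma> (\<beta>\<^sup>2 * (1 + 3 * e))"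
    "measure (gprod n (\<lambda>_. \<mu>) \<sigma>) (space (Leb n) - (\<Union>i<N. cell n \<mu> \<sigma> e (b\<^sup>2 * (1 + 3 * e)) (ws i)))
      \<le> (1 - p) ^ N + 2 / (real n * e\<^sup>2)"
proof -
  let ?P = "gprod n (\<lambda>_. \<mu>) \<sigma>"
  let ?B = "codeball n \<mu> \<sigma> (\<beta>\<^sup>2 * (1 + 3 * e))" and ?E = "cell n \<mu> \<sigma> e (b\<^sup>2 * (1 + 3 * e))"
  let ?F = "{x \<in> space (Leb n). real n * \<sigma>\<^sup>2 * e \<le> \<bar>sqd n (\<lambda>_. \<mu>) x - real n * \<sigma>\<^sup>2\<bar>}"
  interpret P: prob_space ?P by (rule prob_space_gprod[OF s])
  interpret L: product_sigma_finite "\<lambda>_::nat. lborel :: real measure" by standard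
  have Fm: "?F \<in> sets (Leb n)" by measurable
  define S where "S = space (Leb n) - ?F"
  have Sm: "S \<in> sets ?P" using Fm by (auto simp: S_def sets_gprod)
  have Em: "?E w \<in> sets ?P" for w unfolding sets_gprod by measurable
  define c where "c = 1 / 2 * (exp ((1 - e) / 2) * (sqrt (2 * pi) * (\<beta> * b * \<sigma>))) ^ n"
  define v where "v = (exp (1 / 2) * (sqrt (2 * pi) * (\<sigma> * sqrt (\<beta>\<^sup>2 * (1 + 3 * e))))) ^ n"
  have c: "c > 0" using s b be by (simp add: c_def)
  have e3: "1 + 3 * e > 0" using e by simp
  have v: "v > 0" using s be e3 by (simp add: v_def)
  \<comment> \<open>The ratio of the two volumes; the divisor 4 joins the \<open>1 / 2\<close> in
    \<open>c\<close> with the factor 2 lost in averaging.\<close>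
  have "c / (2 * v) = ((exp ((1 - e) / 2) * (sqrt (2 * pi) * (\<beta> * b * \<sigma>))) / (exp (1 / 2) * (sqrt (2 * pi) * (\<sigma> * sqrt (\<beta>\<^sup>2 * (1 + 3 * e)))))) ^ n / 4"
  proof -
    have "1 / 2 * y ^ n / (2 * z ^ n) = (y / z) ^ n / 4" for y z :: real
      by (simp add: power_divide)
    then show ?thesis unfolding c_def v_def .
  qed
  also have "(exp ((1 - e) / 2) * (sqrt (2 * pi) * (\<beta> * b * \<sigma>))) / (exp (1 / 2) * (sqrt (2 * pi) * (\<sigma> * sqrt (\<beta>\<^sup>2 * (1 + 3 * e)))))
    = b * (exp ((1 - e) / 2) / exp (1 / 2)) / sqrt (1 + 3 * e)"
    using s be e3 by (simp add: real_sqrt_mult)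
  also have "exp ((1 - e) / 2) / exp (1 / 2) = exp (- e / 2)"
    by (simp add: exp_diff[symmetric] diff_divide_distrib)
  finally have cv: "c / (2 * v) = p" by (simp add: p_def)
  have b1: "b \<le> 1"
  proof -
    have "b\<^sup>2 \<le> 1\<^sup>2" using bb zero_le_power2[of \<beta>] unfolding power_one by linarith
    then show ?thesis by (rule power2_le_imp_le) simp
  qed
  have p1: "p \<le> 1"
  proof -
    have "b * exp (- e / 2) \<le> 1 * 1" using b b1 e by (intro mult_mono) auto
    also have "1 * 1 \<le> sqrt (1 + 3 * e)" using e by simp
    finally have "b * exp (- e / 2) / sqrt (1 + 3 * e) \<le> 1" using e3 by (simp add: divide_le_eq_1)
    moreover have "0 \<le> b * exp (- e / 2) / sqrt (1 + 3 * e)" using b e3 by simp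
    ultimately have "(b * exp (- e / 2) / sqrt (1 + 3 * e)) ^ n \<le> 1" by (simp add: power_le_one)
    then show ?thesis by (simp add: p_def)
  qed
  let ?W = "{(x, w) \<in> space (Leb n \<Otimes>\<^sub>M Leb n). x \<in> ?E w}"
  have "?W = {z \<in> space (Leb n \<Otimes>\<^sub>M Leb n). real n * \<sigma>\<^sup>2 * (1 - e) \<le> sqd n (\<lambda>_. \<mu>) (fst z)
      \<and> (\<Sum>i<n. (fst z i - snd z i)\<^sup>2) \<le> real n * (\<sigma>\<^sup>2 * (b\<^sup>2 * (1 + 3 * e)))}"
    by (auto simp: cell_def sqd_def space_pair_measure)
  also have "\<dots> \<in> sets (Leb n \<Otimes>\<^sub>M Leb n)" by measurable
  finally have W: "?W \<in> sets (?P \<Otimes>\<^sub>M Leb n)"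
    by (simp add: sets_pair_measure_cong[OF sets_gprod refl])
  have step: "\<exists>w\<in>?B. p * P.prob S' \<le> P.prob (S' \<inter> ?E w)" if S': "S' \<in> P.events" "S' \<subseteq> S" for S'
  proof -
    have Wx: "(x, w) \<in> ?W \<longleftrightarrow> x \<in> ?E w" if "w \<in> ?B" for x w
      using that by (auto simp: cell_def codeball_def space_pair_measure)
    have "(\<lambda>_\<in>{..<n}. \<mu>) \<in> ?B"
      using e3 by (auto simp: codeball_def space_PiM sqd_def)
    then have "?B \<noteq> {}" by auto
    have "\<exists>w\<in>?B. c / (2 * v) * P.prob S' \<le> P.prob {x \<in> S'. (x, w) \<in> ?W}"
    proof (rule P.exists_good_point[OF L.sigma_finite W S'(1) codeball_sets \<open>?B \<noteq> {}\<close> _ v c])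
      show "emeasure (Leb n) ?B \<le> ennreal v"
        unfolding v_def using s be e3 by (intro volume_codeball_le) auto
      fix x assume "x \<in> S'"
      then have x: "x \<in> space (Leb n)" "\<bar>sqd n (\<lambda>_. \<mu>) x - real n * \<sigma>\<^sup>2\<bar> \<le> real n * \<sigma>\<^sup>2 * e"
        using S'(2) by (auto simp: S_def)
      have "{w \<in> ?B. (x, w) \<in> ?W} = {w \<in> ?B. x \<in> ?E w}" using Wx by blast
      then show "ennreal c \<le> emeasure (Leb n) {w \<in> ?B. (x, w) \<in> ?W}"
        using volume_of_good_codewords[OF s b be bb e n x] by (simp add: c_def)
    qed simp
    then obtain w where w: "w \<in> ?B" "p * P.prob S' \<le> P.prob {x \<in> S'. (x, w) \<in> ?W}"
      unfolding cv by blast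
    moreover have "{x \<in> S'. (x, w) \<in> ?W} = S' \<inter> ?E w" using Wx[OF w(1)] by blast
    ultimately show ?thesis by auto
  qed
  obtain ws where ws: "\<forall>i<N. ws i \<in> ?B" and le: "P.prob (S - (\<Union>i<N. ?E (ws i))) \<le> (1 - p) ^ N"
    using P.greedy_covering[of S ?B ?E p N, OF Sm Em p1 step] by auto
  show ?thesis
  proof (rule that[of ws])
    show "\<And>i. i < N \<Longrightarrow> ws i \<in> ?B" using ws by simp
    have "P.prob (space (Leb n) - (\<Union>i<N. ?E (ws i))) \<le> P.prob ((S - (\<Union>i<N. ?E (ws i))) \<union> ?F)"
      using Sm Em Fm by (intro P.finite_measure_mono) (auto simp: S_def sets_gprod)
    also have "\<dots> \<le> P.prob (S - (\<Union>i<N. ?E (ws i))) + P.prob ?F"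
      using Sm Em Fm by (intro measure_Un_le) (auto simp: sets_gprod)
    also have "P.prob ?F \<le> 2 / (real n * e\<^sup>2)" by (rule gprod_shell[OF s e(1) n(1)])
    finally show "P.prob (space (Leb n) - (\<Union>i<N. ?E (ws i))) \<le> (1 - p) ^ N + 2 / (real n * e\<^sup>2)"
      using le by linarith
  qed
qed

text \<open>The inner product of \<open>x - \<mu>\<close> and \<open>y - \<mu>\<close> is split at
  \<open>w\<close>. The part from \<open>w - \<mu>\<close> is small by \<open>yw\<close>, the part
  from \<open>x - w\<close> is at most about \<open>n b \<sigma>X \<sigma>Y\<close>, so the cosine
  stays near or below \<open>b + \<delta>\<close>, short of the critical value
  \<open>b + 2 \<delta>\<close>.\<close>

lemma cell_separation:
  fixes \<mu> \<sigma>X \<sigma>Y D b e \<delta> :: real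
  assumes sig: "\<sigma>X > 0" "\<sigma>Y > 0" and b: "b > 0" and n: "n > 0"
    and \<delta>: "\<delta> = ((\<sigma>X\<^sup>2 + \<sigma>Y\<^sup>2 - D) / (2 * \<sigma>X * \<sigma>Y) - b) / 2"
    and e: "e * (\<sigma>X\<^sup>2 + \<sigma>Y\<^sup>2 + 4 * b * \<sigma>X * \<sigma>Y) \<le> 2 * \<sigma>X * \<sigma>Y * \<delta>"
    and x: "x \<in> cell n \<mu> \<sigma>X e (b\<^sup>2 * (1 + 3 * e)) w"
    and y: "\<bar>sqd n (\<lambda>_. \<mu>) y - real n * \<sigma>Y\<^sup>2\<bar> < real n * \<sigma>Y\<^sup>2 * e"
    and yw: "\<bar>\<Sum>i<n. (w i - \<mu>) * (y i - \<mu>)\<bar> < real n * (\<sigma>X * \<sigma>Y * \<delta>)"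
  shows "D < dist_avg n x y"
proof -
  \<comment> \<open>The weight that balances Young's inequality: \<open>x - w\<close> has norm at
    most about \<open>b \<sigma>X sqrt n\<close>, and \<open>y - \<mu>\<close> about
    \<open>\<sigma>Y sqrt n\<close>.\<close>
  define k where "k = b * \<sigma>X / \<sigma>Y"
  have k: "k > 0" using b sig by (simp add: k_def)
  let ?X = "sqd n (\<lambda>_. \<mu>) x" and ?Y = "sqd n (\<lambda>_. \<mu>) y" and ?W = "sqd n w x"
  have X: "real n * \<sigma>X\<^sup>2 * (1 - e) \<le> ?X" and W: "?W \<le> real n * (\<sigma>X\<^sup>2 * (b\<^sup>2 * (1 + 3 * e)))"
    using x by (auto simp: cell_def)
  have Y: "real n * \<sigma>Y\<^sup>2 * (1 - e) \<le> ?Y" "?Y \<le> real n * \<sigma>Y\<^sup>2 * (1 + e)"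
    using y by (auto simp: algebra_simps)
  have "2 * ((x i - w i) * (y i - \<mu>)) \<le> k * (y i - \<mu>)\<^sup>2 + (x i - w i)\<^sup>2 / k" for i
  proof -
    have "0 \<le> (k * (y i - \<mu>) - (x i - w i))\<^sup>2 / k" using k by simp
    also have "\<dots> = k * (y i - \<mu>)\<^sup>2 + (x i - w i)\<^sup>2 / k - 2 * ((x i - w i) * (y i - \<mu>))"
      using k by (simp add: power2_eq_square field_simps)
    finally show ?thesis by simp
  qed
  then have "(\<Sum>i<n. 2 * ((x i - w i) * (y i - \<mu>))) \<le> (\<Sum>i<n. k * (y i - \<mu>)\<^sup>2 + (x i - w i)\<^sup>2 / k)"
    by (intro sum_mono)
  also have "\<dots> = k * ?Y + ?W / k"
    by (simp add: sqd_def sum.distrib sum_distrib_left sum_divide_distrib)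
  also have "\<dots> \<le> k * (real n * \<sigma>Y\<^sup>2 * (1 + e)) + real n * (\<sigma>X\<^sup>2 * (b\<^sup>2 * (1 + 3 * e))) / k"
    using k Y W by (intro add_mono mult_left_mono divide_right_mono) auto
  also have "\<dots> = real n * (b * \<sigma>X * \<sigma>Y * (2 + 4 * e))"
    unfolding k_def using b sig by (simp add: power2_eq_square field_simps)
  finally have cross: "(\<Sum>i<n. 2 * ((x i - w i) * (y i - \<mu>))) \<le> real n * (b * \<sigma>X * \<sigma>Y * (2 + 4 * e))" .
  have "sqd n y x = (\<Sum>i<n. (x i - \<mu>)\<^sup>2 + (y i - \<mu>)\<^sup>2 - 2 * ((w i - \<mu>) * (y i - \<mu>)) - 2 * ((x i - w i) * (y i - \<mu>)))"
    unfolding sqd_def by (intro sum.cong) (auto simp: power2_eq_square algebra_simps)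
  also have "\<dots> = ?X + ?Y - 2 * (\<Sum>i<n. (w i - \<mu>) * (y i - \<mu>)) - (\<Sum>i<n. 2 * ((x i - w i) * (y i - \<mu>)))"
    by (simp add: sqd_def sum.distrib sum_subtractf sum_distrib_left)
  finally have "real n * \<sigma>X\<^sup>2 * (1 - e) + real n * \<sigma>Y\<^sup>2 * (1 - e) - 2 * (real n * (\<sigma>X * \<sigma>Y * \<delta>))
      - real n * (b * \<sigma>X * \<sigma>Y * (2 + 4 * e)) < sqd n y x"
    using X Y yw cross by linarith
  moreover have "real n * \<sigma>X\<^sup>2 * (1 - e) + real n * \<sigma>Y\<^sup>2 * (1 - e) - 2 * (real n * (\<sigma>X * \<sigma>Y * \<delta>))
      - real n * (b * \<sigma>X * \<sigma>Y * (2 + 4 * e))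
    = real n * (\<sigma>X\<^sup>2 + \<sigma>Y\<^sup>2 - 2 * \<sigma>X * \<sigma>Y * \<delta> - 2 * b * \<sigma>X * \<sigma>Y - e * (\<sigma>X\<^sup>2 + \<sigma>Y\<^sup>2 + 4 * b * \<sigma>X * \<sigma>Y))"
    by (simp add: algebra_simps)
  \<comment> \<open>As \<open>\<delta>\<close> is half the gap, a margin of
    \<open>2 * \<sigma>X * \<sigma>Y * \<delta>\<close> remains, and the error terms in
    \<open>e\<close> fit into it.\<close>
  moreover have "real n * D \<le> real n * (\<sigma>X\<^sup>2 + \<sigma>Y\<^sup>2 - 2 * \<sigma>X * \<sigma>Y * \<delta> - 2 * b * \<sigma>X * \<sigma>Y
      - e * (\<sigma>X\<^sup>2 + \<sigma>Y\<^sup>2 + 4 * b * \<sigma>X * \<sigma>Y))"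
  proof (rule mult_left_mono)
    have "\<sigma>X\<^sup>2 + \<sigma>Y\<^sup>2 - D = 4 * \<sigma>X * \<sigma>Y * \<delta> + 2 * b * \<sigma>X * \<sigma>Y"
      unfolding \<delta> using sig by (simp add: field_simps)
    then show "D \<le> \<sigma>X\<^sup>2 + \<sigma>Y\<^sup>2 - 2 * \<sigma>X * \<sigma>Y * \<delta> - 2 * b * \<sigma>X * \<sigma>Y
      - e * (\<sigma>X\<^sup>2 + \<sigma>Y\<^sup>2 + 4 * b * \<sigma>X * \<sigma>Y)" using e by linarith
  qed simp
  ultimately have "real n * D < sqd n y x" by linarith
  then show ?thesis using n by (simp add: dist_avg_def sqd_def field_simps)
qed

text \<open>From \<open>1 - p \<le> exp (- p)\<close>: with about \<open>a ^ (- n)\<close> cells of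
  share \<open>\<gamma> ^ n / 4\<close> the exponent grows like \<open>(\<gamma> / a) ^ n\<close>.
  The 2 subtracted pays for rounding down and for the reserved signature.\<close>

lemma covering_failure_le:
  fixes a \<gamma> z :: real and N n :: nat
  assumes a: "0 < a" and \<gamma>: "0 \<le> \<gamma>" "\<gamma> \<le> 1" and N: "inverse a ^ n - 2 \<le> real N"
  shows "(1 - \<gamma> ^ n / 4) ^ N \<le> exp (- (((\<gamma> / a) ^ n - 2) / 4))"
proof -
  have g1: "\<gamma> ^ n \<le> 1" "0 \<le> \<gamma> ^ n" using \<gamma> by (auto simp: power_le_one)
  have "(1 - \<gamma> ^ n / 4) ^ N \<le> exp (- (\<gamma> ^ n / 4)) ^ N"
    using g1 exp_ge_add_one_self[of "- (\<gamma> ^ n / 4)"] by (intro power_mono) auto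
  also have "\<dots> = exp (- (real N * (\<gamma> ^ n / 4)))" by (simp add: exp_of_nat_mult[symmetric])
  also have "\<dots> \<le> exp (- (((\<gamma> / a) ^ n - 2) / 4))"
  proof -
    have "(\<gamma> / a) ^ n - 2 \<le> (\<gamma> / a) ^ n - 2 * \<gamma> ^ n" using g1 by simp
    also have "\<dots> = (inverse a ^ n - 2) * \<gamma> ^ n"
      by (simp add: divide_inverse power_mult_distrib algebra_simps)
    also have "\<dots> \<le> real N * \<gamma> ^ n" using N g1 by (intro mult_right_mono) auto
    finally show ?thesis by simp
  qed
  finally show ?thesis .
qed

text \<open>The strict versions of the two inequalities hold at \<open>e = 0\<close>, hence by
  continuity for all small positive \<open>e\<close>.\<close>

lemma achievability_parameters:
  fixes \<sigma>X \<sigma>Y a b \<delta> :: real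
  assumes sig: "\<sigma>X > 0" "\<sigma>Y > 0" and ab: "a < b" and \<delta>: "\<delta> > 0"
  obtains e where "0 < e" "e \<le> 1" "e * (\<sigma>X\<^sup>2 + \<sigma>Y\<^sup>2 + 4 * b * \<sigma>X * \<sigma>Y) \<le> 2 * \<sigma>X * \<sigma>Y * \<delta>"
    "a < b * exp (- e / 2) / sqrt (1 + 3 * e)"
proof -
  let ?C = "\<sigma>X\<^sup>2 + \<sigma>Y\<^sup>2 + 4 * b * \<sigma>X * \<sigma>Y"
  have "((\<lambda>e. e * ?C) \<longlongrightarrow> 0 * ?C) (at_right 0)"
    by (intro tendsto_intros)
  then have "\<forall>\<^sub>F e in at_right 0. e * ?C < 2 * \<sigma>X * \<sigma>Y * \<delta>"
    by (rule order_tendstoD) (use sig \<delta> in simp)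
  moreover have "((\<lambda>e. b * exp (- e / 2) / sqrt (1 + 3 * e)) \<longlongrightarrow> b * exp (- 0 / 2) / sqrt (1 + 3 * 0)) (at_right 0)"
    by (intro tendsto_intros) auto
  then have "\<forall>\<^sub>F e in at_right 0. a < b * exp (- e / 2) / sqrt (1 + 3 * e)"
    by (rule order_tendstoD) (use ab in simp)
  moreover have "\<forall>\<^sub>F e in at_right 0. 0 < (e :: real)" by (rule eventually_at_right_less)
  moreover have "\<forall>\<^sub>F e in at_right 0. e < (1 :: real)"
    by (rule order_tendstoD[OF tendsto_ident_at]) simp
  ultimately have "\<forall>\<^sub>F e in at_right 0. e * ?C < 2 * \<sigma>X * \<sigma>Y * \<delta> \<and> a < b * exp (- e / 2) / sqrt (1 + 3 * e) \<and> 0 < e \<and> e < 1"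
    by eventually_elim simp
  then obtain e where "e * ?C < 2 * \<sigma>X * \<sigma>Y * \<delta>" "a < b * exp (- e / 2) / sqrt (1 + 3 * e)" "0 < e" "e < 1"
    using eventually_happens' trivial_limit_at_right_real by blast
  then show ?thesis by (intro that) auto
qed

lemma achievable_of_bound:
  assumes "\<And>n. n \<ge> 1 \<Longrightarrow> \<exists>T g. id_system R n T g \<and> admissible D n T g \<and> prob_maybe PX PY n T g \<le> f n"
    and "f \<longlonglongrightarrow> 0"
  shows "achievable D PX PY R"
proof -
  have "\<forall>n. \<exists>Tg. n \<ge> 1 \<longrightarrow> id_system R n (fst Tg) (snd Tg) \<and> admissible D n (fst Tg) (snd Tg)
      \<and> prob_maybe PX PY n (fst Tg) (snd Tg) \<le> f n"
    using assms(1) by (metis fst_conv snd_conv)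
  then obtain Tg where Tg: "\<And>n. n \<ge> 1 \<Longrightarrow> id_system R n (fst (Tg n)) (snd (Tg n)) \<and>
      admissible D n (fst (Tg n)) (snd (Tg n)) \<and> prob_maybe PX PY n (fst (Tg n)) (snd (Tg n)) \<le> f n"
    by metis
  have "(\<lambda>n. prob_maybe PX PY n (fst (Tg n)) (snd (Tg n))) \<longlonglongrightarrow> 0"
  proof (rule tendsto_sandwich[OF _ _ tendsto_const assms(2)])
    show "\<forall>\<^sub>F n in sequentially. 0 \<le> prob_maybe PX PY n (fst (Tg n)) (snd (Tg n))"
      by (simp add: prob_maybe_def)
    show "\<forall>\<^sub>F n in sequentially. prob_maybe PX PY n (fst (Tg n)) (snd (Tg n)) \<le> f n"
      using eventually_ge_at_top[of 1] by eventually_elim (use Tg in blast)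
  qed
  then show ?thesis unfolding achievable_def
    by (intro exI[of _ "\<lambda>n. fst (Tg n)"] exI[of _ "\<lambda>n. snd (Tg n)"]) (use Tg in blast)
qed

text \<open>Combines \<open>exists_covering\<close> for the cells, \<open>cell_separation\<close>
  for admissibility and \<open>exists_system_of_cells\<close> for the error bound. The premise
  \<open>le1\<close> keeps \<open>b\<close> below 1, so that \<open>\<beta>\<close> is
  positive.\<close>

lemma achievable_rate_sufficient:
  fixes \<mu> \<sigma>X \<sigma>Y D R :: real
  assumes sig: "\<sigma>X > 0" "\<sigma>Y > 0" and le1: "(\<sigma>X\<^sup>2 + \<sigma>Y\<^sup>2 - D) / (2 * \<sigma>X * \<sigma>Y) \<le> 1"
    and R: "2 powr (- R) < (\<sigma>X\<^sup>2 + \<sigma>Y\<^sup>2 - D) / (2 * \<sigma>X * \<sigma>Y)"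
  shows "achievable D (gaussian \<mu> \<sigma>X) (gaussian \<mu> \<sigma>Y) R"
proof -
  define a where "a = 2 powr (- R)"
  define \<rho> where "\<rho> = (\<sigma>X\<^sup>2 + \<sigma>Y\<^sup>2 - D) / (2 * \<sigma>X * \<sigma>Y)"
  have a: "0 < a" "a < \<rho>" using R by (auto simp: a_def \<rho>_def)
  \<comment> \<open>\<open>a < b\<close> provides enough signatures for the covering, and
    \<open>b < \<rho>\<close> leaves room for the separation.\<close>
  obtain b where b: "a < b" "b < \<rho>" using dense[OF a(2)] by auto
  have b0: "0 < b" and b1: "b < 1" using a b le1 by (auto simp: \<rho>_def)
  define \<beta> where "\<beta> = sqrt (1 - b\<^sup>2)"
  have "b\<^sup>2 < 1" using b0 b1 by (simp add: power_less_one_iff abs_square_less_1)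
  then have be: "0 < \<beta>" and bb: "b\<^sup>2 + \<beta>\<^sup>2 = 1" by (auto simp: \<beta>_def)
  have be1: "\<beta>\<^sup>2 \<le> 1" using bb zero_le_power2[of b] by linarith
  define \<delta> where "\<delta> = (\<rho> - b) / 2"
  have \<delta>: "\<delta> > 0" using b by (simp add: \<delta>_def)
  obtain e where e: "0 < e" "e \<le> 1" and esmall: "e * (\<sigma>X\<^sup>2 + \<sigma>Y\<^sup>2 + 4 * b * \<sigma>X * \<sigma>Y) \<le> 2 * \<sigma>X * \<sigma>Y * \<delta>"
    and ea: "a < b * exp (- e / 2) / sqrt (1 + 3 * e)"
    by (rule achievability_parameters[OF sig b(1) \<delta>])
  define \<gamma> where "\<gamma> = b * exp (- e / 2) / sqrt (1 + 3 * e)"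
  have \<gamma>: "a < \<gamma>" "0 \<le> \<gamma>" using ea a by (auto simp: \<gamma>_def)
  have \<gamma>1: "\<gamma> \<le> 1"
  proof -
    have "b * exp (- e / 2) \<le> 1 * 1" using b0 b1 e by (intro mult_mono) auto
    also have "1 * 1 \<le> sqrt (1 + 3 * e)" using e by simp
    finally show ?thesis using e by (simp add: \<gamma>_def divide_le_eq_1)
  qed
  \<comment> \<open>A positive rate guarantees the reserved signature at every blocklength.\<close>
  have R0: "R > 0"
  proof (rule ccontr)
    assume "\<not> R > 0"
    then have "2 powr 0 \<le> a" unfolding a_def by (intro powr_mono) auto
    then show False using a le1 by (simp add: \<rho>_def)
  qed
  \<comment> \<open>In order: covering failure, atypical norms of \<open>x\<close> and of
    \<open>y\<close> with \<open>2 / (real n * e\<^sup>2)\<close> each, and a \<open>y\<close>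
    correlated with the centre of the cell.\<close>
  define h where "h n = exp (- (((\<gamma> / a) ^ n - 2) / 4)) + 4 / e\<^sup>2 * inverse (real n) + 4 / \<delta>\<^sup>2 * inverse (real n)" for n :: nat
  \<comment> \<open>For short blocklengths Chebyshev is too weak for \<open>exists_covering\<close>;
    the trivial bound 1 serves there without affecting the limit.\<close>
  define f where "f n = (if 2 / (real n * e\<^sup>2) \<le> 1 / 4 then h n else 1)" for n :: nat
  show ?thesis
  proof (rule achievable_of_bound)
    have "filterlim (\<lambda>n. (\<gamma> / a) ^ n) at_top sequentially"
      using \<gamma> a
      by (intro filterlim_at_infinity_imp_filterlim_at_top filterlim_realpow_sequentially_gt1) auto
    then have "filterlim (\<lambda>n. - 2 + (\<gamma> / a) ^ n) at_top sequentially"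
      by (rule filterlim_tendsto_add_at_top[OF tendsto_const])
    then have "filterlim (\<lambda>n. (- 2 + (\<gamma> / a) ^ n) * (1 / 4)) at_top sequentially"
      by (rule filterlim_at_top_mult_tendsto_pos[OF tendsto_const, rotated]) simp
    then have "filterlim (\<lambda>n. - ((- 2 + (\<gamma> / a) ^ n) * (1 / 4))) at_bot sequentially"
      by (simp add: filterlim_uminus_at_bot)
    then have "(\<lambda>n. exp (- ((- 2 + (\<gamma> / a) ^ n) * (1 / 4)))) \<longlonglongrightarrow> 0"
      by (rule filterlim_compose[OF exp_at_bot])
    then have "(\<lambda>n. exp (- (((\<gamma> / a) ^ n - 2) / 4))) \<longlonglongrightarrow> 0" by simp
    then have "h \<longlonglongrightarrow> 0 + 4 / e\<^sup>2 * 0 + 4 / \<delta>\<^sup>2 * 0"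
      unfolding h_def by (intro tendsto_intros lim_inverse_n)
    then have h: "h \<longlonglongrightarrow> 0" by simp
    have "(\<lambda>n. 2 / e\<^sup>2 * inverse (real n)) \<longlonglongrightarrow> 2 / e\<^sup>2 * 0"
      by (intro tendsto_intros lim_inverse_n)
    then have "\<forall>\<^sub>F n in sequentially. 2 / e\<^sup>2 * inverse (real n) < 1 / 4"
      by (rule order_tendstoD) simp
    then have "\<forall>\<^sub>F n in sequentially. f n = h n"
      by eventually_elim (auto simp: f_def divide_simps mult_ac)
    then show "f \<longlonglongrightarrow> 0" using h by (simp add: tendsto_cong)
  next
    fix n :: nat assume n1: "n \<ge> 1"
    then have n: "n > 0" by simp
    have z1: "1 \<le> 2 powr (real n * R)" using R0 by (intro ge_one_powr_ge_zero) auto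
    show "\<exists>T g. id_system R n T g \<and> admissible D n T g \<and> prob_maybe (gaussian \<mu> \<sigma>X) (gaussian \<mu> \<sigma>Y) n T g \<le> f n"
    proof (cases "2 / (real n * e\<^sup>2) \<le> 1 / 4")
      case False
      \<comment> \<open>With no cells every \<open>x\<close> gets the reserved signature, and the
        answer is always \<open>Maybe\<close>.\<close>
      obtain T g where T: "id_system R n T g" "admissible D n T g"
        and pm: "\<And>\<eta>. 0 \<le> \<eta> \<Longrightarrow> (\<And>i::nat. i < 0 \<Longrightarrow> measure (gprod n (\<lambda>_. \<mu>) \<sigma>Y) (space (Leb n) - {}) \<le> \<eta>) \<Longrightarrow>
        prob_maybe (gaussian \<mu> \<sigma>X) (gaussian \<mu> \<sigma>Y) n T g
          \<le> measure (gprod n (\<lambda>_. \<mu>) \<sigma>X) (space (Leb n) - (\<Union>i<0. {})) + \<eta>"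
        by (rule exists_system_of_cells[OF sig, of 0 n R "\<lambda>_. {}" "\<lambda>_. {}" D \<mu>]) (use z1 in auto)
      have "prob_maybe (gaussian \<mu> \<sigma>X) (gaussian \<mu> \<sigma>Y) n T g \<le> measure (gprod n (\<lambda>_. \<mu>) \<sigma>X) (space (Leb n)) + 0"
        by (rule order_trans[OF pm[of 0]]) auto
      also have "\<dots> \<le> 1" using prob_space.prob_le_1[OF prob_space_gprod[OF sig(1)]] by simp
      finally show ?thesis using T False by (auto simp: f_def)
    next
      case True
      \<comment> \<open>All available signatures but the reserved one.\<close>
      define N where "N = nat \<lfloor>2 powr (real n * R)\<rfloor> - 1"
      have "1 \<le> nat \<lfloor>2 powr (real n * R)\<rfloor>" using z1 by (simp add: le_nat_floor)
      then have N1: "real N + 1 = real (nat \<lfloor>2 powr (real n * R)\<rfloor>)" by (simp add: N_def)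
      have card: "real N + 1 \<le> 2 powr (real n * R)"
        unfolding N1 using z1 by (intro of_nat_floor) simp
      have "2 powr (real n * R) < real N + 2" using N1 z1 by linarith
      moreover have "2 powr (real n * R) = inverse a ^ n"
        by (simp add: a_def powr_minus powr_realpow[symmetric] powr_powr mult.commute)
      ultimately have Nge: "inverse a ^ n - 2 \<le> real N" by simp
      obtain ws where ws: "\<And>i. i < N \<Longrightarrow> ws i \<in> codeball n \<mu> \<sigma>X (\<beta>\<^sup>2 * (1 + 3 * e))"
        and cov: "measure (gprod n (\<lambda>_. \<mu>) \<sigma>X) (space (Leb n) - (\<Union>i<N. cell n \<mu> \<sigma>X e (b\<^sup>2 * (1 + 3 * e)) (ws i)))
          \<le> (1 - \<gamma> ^ n / 4) ^ N + 2 / (real n * e\<^sup>2)"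
        by (rule exists_covering[OF sig(1) b0 be bb e n True, of N \<mu>]) (auto simp: \<gamma>_def)
      let ?F = "{y \<in> space (Leb n). real n * \<sigma>Y\<^sup>2 * e \<le> \<bar>sqd n (\<lambda>_. \<mu>) y - real n * \<sigma>Y\<^sup>2\<bar>}"
      let ?I = "\<lambda>i. {y \<in> space (Leb n). real n * (\<sigma>X * \<sigma>Y * \<delta>) \<le> \<bar>\<Sum>j<n. (ws i j - \<mu>) * (y j - \<mu>)\<bar>}"
      \<comment> \<open>\<open>V i\<close> keeps the \<open>y\<close> of typical norm that are
        nearly orthogonal to \<open>ws i - \<mu>\<close>; these are the \<open>y\<close> that
        \<open>cell_separation\<close> handles.\<close>
      define V where "V i = space (Leb n) - (?F \<union> ?I i)" for i
      have FI: "?F \<in> sets (Leb n)" "?I i \<in> sets (Leb n)" for i by measurable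
      have Vm: "V i \<in> sets (Leb n)" for i unfolding V_def using FI by blast
      obtain T g where T: "id_system R n T g" "admissible D n T g"
        and pm: "\<And>\<eta>. 0 \<le> \<eta> \<Longrightarrow> (\<And>i. i < N \<Longrightarrow> measure (gprod n (\<lambda>_. \<mu>) \<sigma>Y) (space (Leb n) - V i) \<le> \<eta>) \<Longrightarrow>
        prob_maybe (gaussian \<mu> \<sigma>X) (gaussian \<mu> \<sigma>Y) n T g
          \<le> measure (gprod n (\<lambda>_. \<mu>) \<sigma>X) (space (Leb n) - (\<Union>i<N. cell n \<mu> \<sigma>X e (b\<^sup>2 * (1 + 3 * e)) (ws i))) + \<eta>"
      proof (rule exists_system_of_cells[OF sig card, of "\<lambda>i. cell n \<mu> \<sigma>X e (b\<^sup>2 * (1 + 3 * e)) (ws i)" V D \<mu>])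
        fix i x y assume "i < N" and x: "x \<in> cell n \<mu> \<sigma>X e (b\<^sup>2 * (1 + 3 * e)) (ws i)" and y: "y \<in> V i"
        show "D < dist_avg n x y"
          by (rule cell_separation[OF sig b0 n _ esmall x]) (use y in \<open>auto simp: V_def \<delta>_def \<rho>_def\<close>)
      qed (use Vm in auto)
      have "prob_maybe (gaussian \<mu> \<sigma>X) (gaussian \<mu> \<sigma>Y) n T g
        \<le> ((1 - \<gamma> ^ n / 4) ^ N + 2 / (real n * e\<^sup>2)) + (2 / (real n * e\<^sup>2) + 4 / (real n * \<delta>\<^sup>2))"
      proof (rule order_trans[OF pm add_right_mono[OF cov]])
        show "0 \<le> 2 / (real n * e\<^sup>2) + 4 / (real n * \<delta>\<^sup>2)" by simp
        fix i assume i: "i < N"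
        have "measure (gprod n (\<lambda>_. \<mu>) \<sigma>Y) (?I i) \<le> \<sigma>Y\<^sup>2 * sqd n (\<lambda>_. \<mu>) (ws i) / (real n * (\<sigma>X * \<sigma>Y * \<delta>))\<^sup>2"
          unfolding sqd_def using n sig \<delta> by (intro gprod_linear) auto
        also have "\<dots> \<le> \<sigma>Y\<^sup>2 * (real n * (\<sigma>X\<^sup>2 * 4)) / (real n * (\<sigma>X * \<sigma>Y * \<delta>))\<^sup>2"
        proof (intro divide_right_mono mult_left_mono)
          have "sqd n (\<lambda>_. \<mu>) (ws i) \<le> real n * (\<sigma>X\<^sup>2 * (\<beta>\<^sup>2 * (1 + 3 * e)))"
            using ws[OF i] by (simp add: codeball_def)
          also have "\<beta>\<^sup>2 * (1 + 3 * e) \<le> 1 * 4" using be1 e by (intro mult_mono) auto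
          finally show "sqd n (\<lambda>_. \<mu>) (ws i) \<le> real n * (\<sigma>X\<^sup>2 * 4)" by (simp add: mult_left_mono)
        qed auto
        also have "\<dots> = 4 / (real n * \<delta>\<^sup>2)" using n sig \<delta> by (simp add: field_simps power2_eq_square)
        finally have I: "measure (gprod n (\<lambda>_. \<mu>) \<sigma>Y) (?I i) \<le> 4 / (real n * \<delta>\<^sup>2)" .
        have "space (Leb n) - V i = ?F \<union> ?I i" by (auto simp: V_def)
        then have "measure (gprod n (\<lambda>_. \<mu>) \<sigma>Y) (space (Leb n) - V i) = measure (gprod n (\<lambda>_. \<mu>) \<sigma>Y) (?F \<union> ?I i)"
          by (rule arg_cong)
        also have "\<dots> \<le> measure (gprod n (\<lambda>_. \<mu>) \<sigma>Y) ?F + measure (gprod n (\<lambda>_. \<mu>) \<sigma>Y) (?I i)"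
          using FI by (intro measure_Un_le) (auto simp: sets_gprod)
        also have "\<dots> \<le> 2 / (real n * e\<^sup>2) + 4 / (real n * \<delta>\<^sup>2)"
          by (intro add_mono gprod_shell[OF sig(2) e(1) n] I)
        finally show "measure (gprod n (\<lambda>_. \<mu>) \<sigma>Y) (space (Leb n) - V i) \<le> 2 / (real n * e\<^sup>2) + 4 / (real n * \<delta>\<^sup>2)" .
      qed
      also have "\<dots> \<le> f n"
      proof -
        have "(1 - \<gamma> ^ n / 4) ^ N \<le> exp (- (((\<gamma> / a) ^ n - 2) / 4))"
          by (rule covering_failure_le[OF a(1) \<gamma>(2) \<gamma>1 Nge])
        moreover have "2 / (real n * e\<^sup>2) + 2 / (real n * e\<^sup>2) = 4 / e\<^sup>2 * inverse (real n)"
          by (simp add: divide_inverse)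
        moreover have "4 / (real n * \<delta>\<^sup>2) = 4 / \<delta>\<^sup>2 * inverse (real n)"
          by (simp add: divide_inverse)
        ultimately show ?thesis using True unfolding f_def h_def by (simp only: if_True)
      qed
      finally show ?thesis using T by blast
    qed
  qed
qed

section \<open>The identification rate\<close>

lemma achievable_antimono:
  assumes "achievable D' PX PY R" "D \<le> D'"
  shows "achievable D PX PY R"
proof -
  have "admissible D' n T g \<Longrightarrow> admissible D n T g" for n T g
    unfolding admissible_def using assms(2) by auto
  then show ?thesis using assms(1) unfolding achievable_def by fast
qed

text \<open>Blocklength 1 decides it: for \<open>R < 0\<close> the set \<open>signatures R 1\<close>
  is empty, yet \<open>T\<close> must take a value in it.\<close>

lemma achievable_rate_nonneg:
  assumes "achievable D PX PY R"
  shows "0 \<le> R"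
proof (rule ccontr)
  assume R: "\<not> 0 \<le> R"
  obtain T g where "id_system R 1 (T (1 :: nat)) (g (1 :: nat))"
    using assms unfolding achievable_def by blast
  then have "T 1 (\<lambda>_\<in>{..<1}. 0) \<in> signatures R 1"
    by (rule measurable_sections(3)) (auto simp: space_PiM)
  then have "1 \<le> 2 powr R" by (auto simp: signatures_def)
  moreover have "2 powr R < 2 powr 0" using R by (intro powr_less_mono) auto
  ultimately show False by simp
qed

text \<open>Whether the infimum is attained stays open, which fits a non-strict converse bound and a
  strict condition for achievability.\<close>

lemma Inf_ereal_eqI:
  assumes "\<And>R. P R \<Longrightarrow> c \<le> R" and "\<And>R. c < R \<Longrightarrow> P R"
  shows "Inf (ereal ` {R. P R}) = ereal c"
proof (rule antisym)
  show "ereal c \<le> Inf (ereal ` {R. P R})" using assms(1) by (auto intro!: Inf_greatest)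
  show "Inf (ereal ` {R. P R}) \<le> ereal c"
  proof (rule ereal_le_epsilon2)
    fix d :: real assume "0 < d"
    then have "P (c + d)" by (intro assms(2)) simp
    then show "Inf (ereal ` {R. P R}) \<le> ereal c + ereal d" by (auto intro!: Inf_lower)
  qed
qed

theorem theorem1:
  fixes \<mu> \<sigma>X \<sigma>Y D :: real
  assumes "\<sigma>X > 0" and "\<sigma>Y > 0" and "D \<ge> 0"
  shows "R_ID D (gaussian \<mu> \<sigma>X) (gaussian \<mu> \<sigma>Y) =
    (if D < (\<sigma>X - \<sigma>Y)\<^sup>2 then 0
     else if D < \<sigma>X\<^sup>2 + \<sigma>Y\<^sup>2
       then ereal (log 2 (2 * \<sigma>X * \<sigma>Y / (\<sigma>X\<^sup>2 + \<sigma>Y\<^sup>2 - D)))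
     else \<infinity>)"
proof -
  note sig = assms(1,2)
  let ?ach = "\<lambda>D. achievable D (gaussian \<mu> \<sigma>X) (gaussian \<mu> \<sigma>Y)"
  define \<rho> where "\<rho> D = (\<sigma>X\<^sup>2 + \<sigma>Y\<^sup>2 - D) / (2 * \<sigma>X * \<sigma>Y)" for D
  have low: "2 powr (- R) \<le> \<rho> D" if "?ach D R" for D R
    using achievable_rate_lower_bound[OF sig that] by (simp add: \<rho>_def)
  have high: "?ach D R" if "\<rho> D \<le> 1" "2 powr (- R) < \<rho> D" for D R
    using achievable_rate_sufficient[OF sig, of D R \<mu>] that by (simp add: \<rho>_def)
  consider "D < (\<sigma>X - \<sigma>Y)\<^sup>2" | "\<not> D < (\<sigma>X - \<sigma>Y)\<^sup>2" "D < \<sigma>X\<^sup>2 + \<sigma>Y\<^sup>2"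
    | "\<not> D < (\<sigma>X - \<sigma>Y)\<^sup>2" "\<not> D < \<sigma>X\<^sup>2 + \<sigma>Y\<^sup>2" by linarith
  then show ?thesis
  proof cases
    case 1
    \<comment> \<open>At the threshold distortion every positive rate is achievable, and a smaller
      \<open>D\<close> only weakens admissibility.\<close>
    have \<rho>1: "\<rho> ((\<sigma>X - \<sigma>Y)\<^sup>2) = 1"
      using sig by (simp add: \<rho>_def power2_eq_square field_simps)
    have "R_ID D (gaussian \<mu> \<sigma>X) (gaussian \<mu> \<sigma>Y) = ereal 0"
      unfolding R_ID_def
    proof (rule Inf_ereal_eqI)
      fix R :: real assume "0 < R"
      then have "2 powr (- R) < 2 powr 0" by (intro powr_less_mono) auto
      then have "?ach ((\<sigma>X - \<sigma>Y)\<^sup>2) R" by (intro high) (simp_all add: \<rho>1)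
      then show "?ach D R" by (rule achievable_antimono) (use 1 in simp)
    qed (rule achievable_rate_nonneg)
    then show ?thesis using 1 by (simp add: zero_ereal_def)
  next
    case 2
    have \<rho>0: "\<rho> D > 0" using 2 sig by (simp add: \<rho>_def)
    have \<rho>1: "\<rho> D \<le> 1" using 2 sig by (simp add: \<rho>_def power2_eq_square algebra_simps)
    have eq: "log 2 (2 * \<sigma>X * \<sigma>Y / (\<sigma>X\<^sup>2 + \<sigma>Y\<^sup>2 - D)) = - log 2 (\<rho> D)"
      using \<rho>0 by (simp add: \<rho>_def log_inverse[symmetric])
    have "R_ID D (gaussian \<mu> \<sigma>X) (gaussian \<mu> \<sigma>Y) = ereal (- log 2 (\<rho> D))"
      unfolding R_ID_def
    proof (rule Inf_ereal_eqI)
      fix R assume "?ach D R"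
      from low[OF this] show "- log 2 (\<rho> D) \<le> R" using \<rho>0 by (simp add: powr_le_iff)
    next
      fix R assume "- log 2 (\<rho> D) < R"
      then have "2 powr (- R) < \<rho> D" using \<rho>0 by (simp add: powr_less_iff)
      then show "?ach D R" by (rule high[OF \<rho>1])
    qed
    then show ?thesis using 2 eq by simp
  next
    case 3
    \<comment> \<open>A power of 2 is positive and cannot be at most \<open>\<rho> D\<close>, so no
      rate is achievable and the infimum is over the empty set.\<close>
    have "\<rho> D \<le> 0" using 3 sig by (auto simp: \<rho>_def divide_le_0_iff)
    then have "\<not> ?ach D R" for R using low[of D R] powr_gt_zero[of 2 "- R"] by fastforce
    then show ?thesis using 3 by (simp add: R_ID_def top_ereal_def)
  qed
qed

end
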